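(* Let $k_1,k_2\in\mathbb{Z}$, and let $\varphi_1,\varphi_2$ and $\psi$ be radial T-functions. Then the following statements hold. (1) The commutator $[T_{e^{ik_1\theta}\varphi_1},T_{e^{ik_2\theta}\varphi_2}]$ has finite rank on $L_h^2$ if and only if $[T_{e^{ik_1\theta}\varphi_1},T_{e^{ik_2\theta}\varphi_2}]$ has finite rank on $L_a^2$. (2) If the generalized semicommutator $T_{e^{ik_1\theta}\varphi_1}T_{e^{ik_2\theta}\varphi_2}-T_{e^{i(k_1+k_2)\theta}\psi}$ has finite rank on $L_h^2$, then both $T_{e^{ik_1\theta}\varphi_1}T_{e^{ik_2\theta}\varphi_2}-T_{e^{i(k_1+k_2)\theta}\psi}$ and $T_{e^{ik_2\theta}\varphi_2}T_{e^{ik_1\theta}\varphi_1}-T_{e^{i(k_1+k_2)\theta}\psi}$ have finite rank on $L_a^2$.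
   Context: $D$ is the open unit disk in $\mathbb{C}$ and $dA$ is Lebesgue area measure on $D$ normalized so that $D$ has measure $1$. $L_a^2$ is the Bergman space of analytic functions in $L^2(D,dA)$, and $P$ is the Bergman projection $Pf(z)=\int_D\frac{f(w)}{(1-z\bar w)^2}\,dA(w)$, which extends to $L^1(D,dA)$ by this formula. $L_h^2=L_a^2+\overline{L_a^2}$ is the harmonic Bergman space of harmonic functions in $L^2(D,dA)$, with orthogonal projection $Q$ given by $Qf(z)=\int_D\left(\frac{1}{(1-z\bar w)^2}+\frac{1}{(1-\bar z w)^2}-1\right)f(w)\,dA(w)$, also extended to $L^1(D,dA)$. A function $u\in L^1(D,dA)$ is a T-function if $h\mapsto Q(uh)$, densely defined on harmonic polynomials, is bounded in the $L_h^2$ norm. For a T-function $u$, the Toeplitz operator $T_u$ on $L_h^2$ is the continuous extension of $h\mapsto Q(uh)$, and the Toeplitz operator $T_u$ on $L_a^2$ is the bounded operator extending $h\mapsto P(uh)$ from the analytic polynomials. Points of $D$ are written $re^{i\theta}$; a radial T-function is a T-function depending only on $r$, and for $k\in\mathbb{Z}$, $e^{ik\theta}\varphi(r)$ is a T-function iff $\varphi$ is. $[A,B]=AB-BA$. A bounded operator has finite rank if the closure of its range is finite dimensional. *)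

theory Defs
  imports "HOL-Complex_Analysis.Complex_Analysis" "HOL-Library.Function_Algebras"
begin

abbreviation disk :: "complex set" (\<open>\<bbbD>\<close>) where
  "\<bbbD> \<equiv> ball 0 1"

definition disk_measure :: "complex measure" where
  "disk_measure = uniform_measure (lebesgue_on \<bbbD>) \<bbbD>"

definition square_integrable :: "(complex \<Rightarrow> complex) \<Rightarrow> bool" where
  "square_integrable f \<longleftrightarrow>
     f \<in> borel_measurable disk_measure \<and> integrable disk_measure (\<lambda>z. (norm (f z))\<^sup>2)"

definition L2_norm_disk :: "(complex \<Rightarrow> complex) \<Rightarrow> real" where
  "L2_norm_disk f = sqrt (LINT z|disk_measure. (norm (f z))\<^sup>2)"

text \<open>
  A function on the disk is represented by its extension by zero to the whole plane. Elements of
  the two Bergman spaces are continuous on the disk, so with this convention they are equal as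
  elements of \<open>L\<^sup>2\<close> exactly when they are equal as HOL functions.
\<close>

definition on_disk :: "(complex \<Rightarrow> complex) \<Rightarrow> complex \<Rightarrow> complex" where
  "on_disk f = (\<lambda>z. if z \<in> \<bbbD> then f z else 0)"

definition bergman :: "(complex \<Rightarrow> complex) set" where
  "bergman = {f. f holomorphic_on \<bbbD> \<and> square_integrable f \<and> (\<forall>z. z \<notin> \<bbbD> \<longrightarrow> f z = 0)}"

definition harmonic_bergman :: "(complex \<Rightarrow> complex) set" where
  "harmonic_bergman = {(\<lambda>z. f z + cnj (g z)) | f g. f \<in> bergman \<and> g \<in> bergman}"

definition bergman_proj :: "(complex \<Rightarrow> complex) \<Rightarrow> complex \<Rightarrow> complex" where
  "bergman_proj f = on_disk (\<lambda>z. LINT w|disk_measure. f w / (1 - z * cnj w)\<^sup>2)"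

definition harmonic_proj :: "(complex \<Rightarrow> complex) \<Rightarrow> complex \<Rightarrow> complex" where
  "harmonic_proj f = on_disk (\<lambda>z. LINT w|disk_measure.
     (1 / (1 - z * cnj w)\<^sup>2 + 1 / (1 - cnj z * w)\<^sup>2 - 1) * f w)"

definition analytic_polys :: "(complex \<Rightarrow> complex) set" where
  "analytic_polys = {on_disk (poly p) | p. True}"

definition harmonic_polys :: "(complex \<Rightarrow> complex) set" where
  "harmonic_polys = {on_disk (\<lambda>z. poly p z + cnj (poly q z)) | p q. True}"

definition T_function :: "(complex \<Rightarrow> complex) \<Rightarrow> bool" where
  "T_function u \<longleftrightarrow> integrable disk_measure u \<and>
     (\<exists>C. \<forall>h\<in>harmonic_polys. harmonic_proj (\<lambda>w. u w * h w) \<in> harmonic_bergman \<and>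
        L2_norm_disk (harmonic_proj (\<lambda>w. u w * h w)) \<le> C * L2_norm_disk h)"

text \<open>Membership in \<open>L\<^sup>1\<close> only fixes a function almost everywhere, so radiality is required
  almost everywhere.\<close>

definition radial :: "(complex \<Rightarrow> complex) \<Rightarrow> bool" where
  "radial \<phi> \<longleftrightarrow> (\<exists>g :: real \<Rightarrow> complex. AE z in disk_measure. \<phi> z = g (norm z))"

definition radial_T_function :: "(complex \<Rightarrow> complex) \<Rightarrow> bool" where
  "radial_T_function \<phi> \<longleftrightarrow> T_function \<phi> \<and> radial \<phi>"

text \<open>The function \<open>e\<^sup>i\<^sup>k\<^sup>\<theta> \<phi>\<close>, where \<open>z = r e\<^sup>i\<^sup>\<theta>\<close>.\<close>

definition quasihom :: "int \<Rightarrow> (complex \<Rightarrow> complex) \<Rightarrow> complex \<Rightarrow> complex" where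
  "quasihom k \<phi> = (\<lambda>z. cis (real_of_int k * Arg z) * \<phi> z)"

definition bounded_operator_on ::
  "(complex \<Rightarrow> complex) set \<Rightarrow> ((complex \<Rightarrow> complex) \<Rightarrow> (complex \<Rightarrow> complex)) \<Rightarrow> bool" where
  "bounded_operator_on H T \<longleftrightarrow>
     (\<forall>f\<in>H. T f \<in> H) \<and>
     (\<forall>f\<in>H. \<forall>g\<in>H. T (f + g) = T f + T g) \<and>
     (\<forall>c. \<forall>f\<in>H. T (\<lambda>z. c * f z) = (\<lambda>z. c * T f z)) \<and>
     (\<exists>C. \<forall>f\<in>H. L2_norm_disk (T f) \<le> C * L2_norm_disk f)"

text \<open>
  The bounded operator on \<open>H\<close> that extends the densely defined map \<open>S\<close> with domain \<open>P\<close>. It is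
  unique because \<open>P\<close> is dense in \<open>H\<close> in both uses below and its values outside \<open>H\<close> are fixed
  by \<^const>\<open>extensional\<close>.
\<close>

definition bounded_extension ::
  "(complex \<Rightarrow> complex) set \<Rightarrow> (complex \<Rightarrow> complex) set \<Rightarrow>
   ((complex \<Rightarrow> complex) \<Rightarrow> (complex \<Rightarrow> complex)) \<Rightarrow>
   (complex \<Rightarrow> complex) \<Rightarrow> (complex \<Rightarrow> complex)" where
  "bounded_extension H P S =
     (THE T. T \<in> extensional H \<and> bounded_operator_on H T \<and> (\<forall>h\<in>P. T h = S h))"

definition toeplitz_h :: "(complex \<Rightarrow> complex) \<Rightarrow> (complex \<Rightarrow> complex) \<Rightarrow> (complex \<Rightarrow> complex)" where
  "toeplitz_h u =
     bounded_extension harmonic_bergman harmonic_polys (\<lambda>h. harmonic_proj (\<lambda>w. u w * h w))"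

definition toeplitz_a :: "(complex \<Rightarrow> complex) \<Rightarrow> (complex \<Rightarrow> complex) \<Rightarrow> (complex \<Rightarrow> complex)" where
  "toeplitz_a u =
     bounded_extension bergman analytic_polys (\<lambda>h. bergman_proj (\<lambda>w. u w * h w))"

global_interpretation fun_space: vector_space "\<lambda>(c::complex) (f::complex \<Rightarrow> complex) z. c * f z"
  by unfold_locales (auto simp: fun_eq_iff algebra_simps)

definition finite_dimensional :: "(complex \<Rightarrow> complex) set \<Rightarrow> bool" where
  "finite_dimensional V \<longleftrightarrow> (\<exists>B. finite B \<and> B \<subseteq> V \<and> V \<subseteq> fun_space.span B)"

definition L2_closure_in ::
  "(complex \<Rightarrow> complex) set \<Rightarrow> (complex \<Rightarrow> complex) set \<Rightarrow> (complex \<Rightarrow> complex) set" where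
  "L2_closure_in H R = {f \<in> H. \<forall>\<epsilon>>0. \<exists>g\<in>R. L2_norm_disk (f - g) < \<epsilon>}"

definition finite_rank_on ::
  "(complex \<Rightarrow> complex) set \<Rightarrow> ((complex \<Rightarrow> complex) \<Rightarrow> (complex \<Rightarrow> complex)) \<Rightarrow> bool" where
  "finite_rank_on H T \<longleftrightarrow> finite_dimensional (L2_closure_in H (T ` H))"

definition commutator ::
  "((complex \<Rightarrow> complex) \<Rightarrow> (complex \<Rightarrow> complex)) \<Rightarrow>
   ((complex \<Rightarrow> complex) \<Rightarrow> (complex \<Rightarrow> complex)) \<Rightarrow> (complex \<Rightarrow> complex) \<Rightarrow> (complex \<Rightarrow> complex)" where
  "commutator A B = (\<lambda>f. A (B f) - B (A f))"

end

theory Submission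
  imports Defs "HOL-Probability.Distribution_Functions"
begin

text \<open>
  Every function in the harmonic Bergman space has a unique expansion in the harmonic monomials
  \<open>z\<^sup>n\<close> and \<open>cnj z\<^sup>n\<close>, here indexed by one integer (\<^term>\<open>n < 0\<close> for the conjugates), and its
  squared norm is the sum of \<open>\<bar>c\<^sub>n\<bar>\<^sup>2 / (\<bar>n\<bar> + 1)\<close>. The analytic Bergman space consists of the
  functions whose coefficients of negative index vanish. In these coordinates the Toeplitz operator
  with symbol \<open>e\<^sup>i\<^sup>k\<^sup>\<theta> \<phi>(r)\<close> is a weighted shift by \<open>k\<close>: it sends the monomial of index \<open>n\<close> to the one
  of index \<open>n + k\<close>, times \<open>w(n + k) b(n)\<close>, where \<open>w(n) = \<bar>n\<bar> + 1\<close> comes from the normalisation of the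
  monomials and \<open>b(n) = \<integral> \<phi> r\<^bsup>\<bar>n\<bar> + \<bar>n + k\<bar>\<^esup>\<close>. On the analytic space the same formula holds as long as
  no index is negative.

  The products and differences of such operators are again weighted shifts, and a weighted shift has
  finite rank exactly if only finitely many of its weights are nonzero. On the analytic space only
  the weights at large positive \<open>n\<close> matter, and there they coincide with those on the
  harmonic space. The bridge between positive and negative indices is a reflection. With
  \<open>K = k1 + k2\<close>, the moment factors satisfy \<open>b(- n - k) = b(n)\<close>, hence \<open>n \<mapsto> - n - K\<close> carries the weight of
  \<open>T1 T2\<close> (up to the nonzero factors \<open>w\<close>) to the weight of the product in the other order \<open>T2 T1\<close>, and
  fixes the weight of \<open>T\<^bsub>\<psi>\<^esub>\<close>. So the weights of the commutator vanish at \<open>n\<close> iff they vanish at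
  \<open>- n - K\<close>, and finitely many nonzero weights on one half line mean finitely many on the other; for
  the semicommutator the negative half line reports on the product in the other order.

  The analysis behind this is as follows. Orthogonality of the monomials and the diagonal action of
  \<open>e\<^sup>i\<^sup>k\<^sup>\<theta> \<phi>(r)\<close> follow from rotation invariance of the area measure, their norms from the fact that
  \<open>\<bar>z\<bar>\<^sup>2\<close> is uniformly distributed. Bessel's inequality (\<open>bessel_inequality\<close>) and Fatou's lemma
  (\<open>expansion_norm_le\<close>) identify both Bergman spaces with weighted sequence spaces (\<open>bergman_eq\<close>,
  \<open>harmonic_bergman_eq\<close>). A radial T-function has bounded weights for \<open>k = 0\<close>, and
  \<open>sym_coef_bounded\<close> transfers this to every \<open>k\<close>. Bounded weights and density of the polynomials
  then pin down the bounded extension (\<open>bounded_extension_is_shift\<close>).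
\<close>

section \<open>Rotations and the radial distribution of area on the disk\<close>

text \<open>The image of Lebesgue measure under a linear isometry is translation invariant, and a
  translation-invariant measure is determined up to a factor: integrating
  \<open>1\<^sub>A(R x) 1\<^sub>B(y)\<close> over all \<open>x\<close> and \<open>y\<close>, shifting first \<open>y\<close> and then \<open>x\<close>, exchanges the roles of the
  two measures. Taking for \<open>B\<close> the unit ball, which \<open>R\<close> preserves, shows that the factor is \<open>1\<close>.\<close>
lemma lborel_isometry_emeasure:
  fixes R :: "'a::euclidean_space \<Rightarrow> 'a"
  assumes lin: "linear R" and iso: "\<And>x. norm (R x) = norm x"
    and A: "A \<in> sets borel"
  shows "emeasure lborel (R -` A) = emeasure lborel A"
proof -
  have Rm[measurable]: "R \<in> borel \<rightarrow>\<^sub>M borel"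
    using lin by (intro borel_measurable_continuous_onI linear_continuous_on) (simp add: linear_linear)
  have "inj R"
  proof (rule injI)
    fix x y assume "R x = R y"
    then have "norm (R (x - y)) = 0" by (simp add: linear_diff[OF lin])
    then show "x = y" by (simp add: iso)
  qed
  then have surjR: "surj R"
    using linear_injective_imp_surjective[OF lin] by simp
  note A[measurable]
  define B :: "'a set" where "B = ball 0 1"
  have B[measurable]: "B \<in> sets borel" by (simp add: B_def)
  have shift: "(\<integral>\<^sup>+x. f x \<partial>lborel) = (\<integral>\<^sup>+x. f (c + x) \<partial>lborel)"
    if [measurable]: "f \<in> borel_measurable borel" for f :: "'a \<Rightarrow> ennreal" and c
  proof -
    have "(\<integral>\<^sup>+x. f x \<partial>lborel) = (\<integral>\<^sup>+x. f x \<partial>(distr lborel borel ((+) c)))"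
      by (simp add: lborel_distr_plus)
    also have "\<dots> = (\<integral>\<^sup>+x. f (c + x) \<partial>lborel)"
      by (subst nn_integral_distr) auto
    finally show ?thesis .
  qed
  have BR: "indicator B (- R x) = (indicator B x :: ennreal)" for x
    by (simp add: B_def indicator_def iso)
  have "emeasure lborel (R -` A) * emeasure lborel B =
      (\<integral>\<^sup>+x. indicator A (R x) * (\<integral>\<^sup>+y. indicator B y \<partial>lborel) \<partial>lborel)"
  proof -
    have "emeasure lborel (R -` A) = (\<integral>\<^sup>+x. indicator (R -` A) x \<partial>lborel)"
      using measurable_sets[OF Rm A] by (simp add: space_borel)
    also have "\<dots> = (\<integral>\<^sup>+x. indicator A (R x) \<partial>lborel)"
      by (intro nn_integral_cong) (simp add: indicator_def)
    finally show ?thesis by (simp add: nn_integral_multc)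
  qed
  also have "\<dots> = (\<integral>\<^sup>+x. \<integral>\<^sup>+y. indicator A (R x) * indicator B (- R x + y) \<partial>lborel \<partial>lborel)"
  proof (rule nn_integral_cong)
    fix x
    show "indicator A (R x) * (\<integral>\<^sup>+y. indicator B y \<partial>lborel)
        = (\<integral>\<^sup>+y. indicator A (R x) * indicator B (- R x + y) \<partial>lborel)"
      by (subst shift[of "indicator B" "- R x"]) (simp_all add: nn_integral_cmult)
  qed
  also have "\<dots> = (\<integral>\<^sup>+y. \<integral>\<^sup>+x. indicator A (R x) * indicator B (- R x + y) \<partial>lborel \<partial>lborel)"
    by (rule lborel_pair.Fubini') measurable
  also have "\<dots> = (\<integral>\<^sup>+y. \<integral>\<^sup>+x. indicator A (y + R x) * indicator B (- R x) \<partial>lborel \<partial>lborel)"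
  proof (rule nn_integral_cong)
    fix y :: 'a
    obtain c where c: "y = R c" using surjR by blast
    show "(\<integral>\<^sup>+x. indicator A (R x) * indicator B (- R x + y) \<partial>lborel)
        = (\<integral>\<^sup>+x. indicator A (y + R x) * indicator B (- R x) \<partial>lborel)"
      by (subst shift[where c = c]) (auto simp: c linear_add[OF lin])
  qed
  also have "\<dots> = (\<integral>\<^sup>+x. \<integral>\<^sup>+y. indicator A (y + R x) * indicator B x \<partial>lborel \<partial>lborel)"
    unfolding BR by (rule lborel_pair.Fubini') measurable
  also have "\<dots> = (\<integral>\<^sup>+x. \<integral>\<^sup>+y. indicator A (R x + y) * indicator B x \<partial>lborel \<partial>lborel)"
    by (simp add: add.commute)
  also have "\<dots> = (\<integral>\<^sup>+x. emeasure lborel A * indicator B x \<partial>lborel)"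
    by (simp add: nn_integral_multc flip: shift[of "indicator A"])
  also have "\<dots> = emeasure lborel A * emeasure lborel B"
    by (simp add: nn_integral_cmult)
  finally have eq: "emeasure lborel (R -` A) * emeasure lborel B = emeasure lborel A * emeasure lborel B" .
  have fin: "emeasure lborel B \<noteq> \<infinity>" "emeasure lborel B \<noteq> 0"
    using less_imp_neq[OF unit_ball_vol_pos[OF of_nat_0_le_iff[of "DIM('a)"]], symmetric]
    by (simp_all add: B_def emeasure_ball)
  show ?thesis
    using eq fin by (simp add: ennreal_mult_cancel_left mult.commute[of _ "emeasure lborel B"])
qed

lemma lebesgue_isometry:
  fixes R :: "'a::euclidean_space \<Rightarrow> 'a"
  assumes lin: "linear R" and iso: "\<And>x. norm (R x) = norm x"
  shows "R \<in> lebesgue \<rightarrow>\<^sub>M lebesgue" "distr lebesgue lebesgue R = lebesgue"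
proof -
  have Rm[measurable]: "R \<in> borel \<rightarrow>\<^sub>M borel"
    using lin by (intro borel_measurable_continuous_onI linear_continuous_on) (simp add: linear_linear)
  have d: "distr lebesgue lborel R = lborel"
  proof (rule measure_eqI)
    show "emeasure (distr lebesgue lborel R) A = emeasure lborel A"
      if "A \<in> sets (distr lebesgue lborel R)" for A
      using that lborel_isometry_emeasure[OF lin iso, of A] measurable_sets[OF Rm, of A]
      by (subst emeasure_distr) (auto simp: measurable_completion)
  qed simp
  show "R \<in> lebesgue \<rightarrow>\<^sub>M lebesgue"
    by (rule completion.measurable_completion2) (auto simp: d measurable_completion)
  show "distr lebesgue lebesgue R = lebesgue"
    by (subst completion.completion_distr_eq[symmetric]) (auto simp: d measurable_completion)
qed

lemma sets_disk_measure: "sets disk_measure = sets (lebesgue_on \<bbbD>)"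
  by (simp add: disk_measure_def)

lemma space_disk_measure [simp]: "space disk_measure = \<bbbD>"
  by (simp add: disk_measure_def)

lemma emeasure_lebesgue_disk: "emeasure lebesgue (ball (0::complex) r) = ennreal (pi * r\<^sup>2)" if "r \<ge> 0"
  using that by (simp add: emeasure_ball unit_ball_vol_2 )

lemma emeasure_disk_measure:
  assumes "A \<in> sets disk_measure"
  shows "emeasure disk_measure A = emeasure lebesgue A / ennreal pi"
proof -
  have A: "A \<in> sets (lebesgue_on \<bbbD>)" using assms by (simp add: disk_measure_def)
  then have AD: "A \<subseteq> \<bbbD>" using sets.sets_into_space by fastforce
  have D: "\<bbbD> \<in> sets (lebesgue_on \<bbbD>)" by (metis sets.top space_lebesgue_on)
  have "emeasure disk_measure A = emeasure (lebesgue_on \<bbbD>) (\<bbbD> \<inter> A) / emeasure (lebesgue_on \<bbbD>) \<bbbD>"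
    unfolding disk_measure_def by (rule emeasure_uniform_measure[OF D A])
  also have "\<bbbD> \<inter> A = A" using AD by blast
  also have "emeasure (lebesgue_on \<bbbD>) A = emeasure lebesgue A"
    using AD by (intro emeasure_restrict_space) auto
  also have "emeasure (lebesgue_on \<bbbD>) \<bbbD> = emeasure lebesgue \<bbbD>"
    by (intro emeasure_restrict_space) auto
  finally show ?thesis using emeasure_lebesgue_disk[of 1] by simp
qed

interpretation disk: prob_space disk_measure
proof
  have "ennreal pi / ennreal pi = 1" using divide_ennreal[of pi pi] by simp
  then show "emeasure disk_measure (space disk_measure) = 1"
    using emeasure_disk_measure[of \<bbbD>] emeasure_lebesgue_disk[of 1]
    by (metis pi_ge_zero mult.right_neutral one_power2 sets.top space_disk_measure zero_le_one)
qed

lemma disk_measurable_borel: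
  assumes "f \<in> borel_measurable borel" shows "f \<in> borel_measurable disk_measure"
proof -
  have "f \<in> borel_measurable (lebesgue_on \<bbbD>)"
    using assms by (intro measurable_restrict_space1) (simp add: measurable_completion)
  then show ?thesis
    by (simp add: disk_measure_def cong: measurable_cong_sets)
qed

lemma disk_measurable_ident [measurable]: "(\<lambda>z. z) \<in> borel_measurable disk_measure"
  by (rule disk_measurable_borel) simp

lemma
  assumes u: "norm u = 1"
  shows disk_rotation_measurable: "(\<lambda>z. u * z) \<in> disk_measure \<rightarrow>\<^sub>M disk_measure"
    and disk_rotation_distr: "distr disk_measure disk_measure (\<lambda>z. u * z) = disk_measure"
proof -
  have R: "linear ((*) u)" "norm (u * x) = norm x" for x
    using u by (auto simp: norm_mult linear_conv_bounded_linear bounded_linear_mult_right)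
  note L = lebesgue_isometry[OF R]
  have "(\<lambda>z. u * z) \<in> lebesgue_on \<bbbD> \<rightarrow>\<^sub>M lebesgue_on \<bbbD>"
    by (intro measurable_restrict_space3 L) (use u in \<open>auto simp: norm_mult\<close>)
  then show m: "(\<lambda>z. u * z) \<in> disk_measure \<rightarrow>\<^sub>M disk_measure"
    by (simp add: disk_measure_def cong: measurable_cong_sets)
  show "distr disk_measure disk_measure (\<lambda>z. u * z) = disk_measure"
  proof (rule measure_eqI)
    fix A assume "A \<in> sets (distr disk_measure disk_measure (\<lambda>z. u * z))"
    then have A: "A \<in> sets disk_measure" by simp
    then have AD: "A \<subseteq> \<bbbD>" and AL: "A \<in> sets lebesgue"
      using sets.sets_into_space[OF A] by (auto simp: sets_disk_measure sets_restrict_space)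
    have "emeasure lebesgue ((*) u -` A) = emeasure lebesgue A"
      using L AL by (metis Int_UNIV_right emeasure_distr space_completion space_lborel space_borel)
    moreover have "(*) u -` A \<inter> space disk_measure = (*) u -` A"
      using AD u by (auto simp: norm_mult)
    moreover have "(*) u -` A \<inter> space disk_measure \<in> sets disk_measure"
      using measurable_sets[OF m A] .
    ultimately show "emeasure (distr disk_measure disk_measure (\<lambda>z. u * z)) A = emeasure disk_measure A"
      using A m by (subst emeasure_distr) (simp_all add: emeasure_disk_measure)
  qed simp
qed

text \<open>The disk of radius \<open>sqrt x\<close> has normalised area \<open>x\<close>. This replaces polar coordinates in the
  computation of the norms of the monomials.\<close>
lemma disk_norm_sq_distr:
  "distr disk_measure borel (\<lambda>z. (norm z)\<^sup>2) = uniform_measure lborel {0..1::real}"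
proof (rule cdf_unique)
  have m[measurable]: "(\<lambda>z. (norm z)\<^sup>2) \<in> borel_measurable disk_measure" by measurable
  show "real_distribution (distr disk_measure borel (\<lambda>z. (norm z)\<^sup>2))"
    by (rule disk.real_distribution_distr) measurable
  interpret U: prob_space "uniform_measure lborel {0..1::real}"
    by (rule prob_space_uniform_measure) auto
  show "real_distribution (uniform_measure lborel {0..1::real})"
    by unfold_locales auto
  show "cdf (distr disk_measure borel (\<lambda>z. (norm z)\<^sup>2)) = cdf (uniform_measure lborel {0..1::real})"
  proof
    fix x :: real
    \<comment> \<open>both distribution functions are the truncation of \<^term>\<open>x\<close> to the unit interval\<close>
    define y where "y = max 0 (min 1 x)"
    have y: "0 \<le> y" "y \<le> 1" by (auto simp: y_def)
    have 1: "emeasure disk_measure ((\<lambda>z. (norm z)\<^sup>2) -` {..x} \<inter> \<bbbD>) = ennreal y"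
    proof (cases "x < 0")
      case True
      then have "(\<lambda>z::complex. (norm z)\<^sup>2) -` {..x} \<inter> \<bbbD> = {}"
        by auto (smt (verit) zero_le_power2)
      then show ?thesis using True by (simp add: y_def)
    next
      case False
      define S where "S = (\<lambda>z::complex. (norm z)\<^sup>2) -` {..x} \<inter> \<bbbD>"
      have S: "S \<in> sets disk_measure"
        unfolding S_def
        using measurable_sets[OF m borel_closed[OF closed_atMost], unfolded space_disk_measure] .
      have n: "(norm z)\<^sup>2 \<le> x \<longleftrightarrow> norm z \<le> sqrt x" for z :: complex
        by (subst real_sqrt_le_iff[symmetric]) simp
      have "emeasure lebesgue S = ennreal (pi * y)"
      proof (cases "x < 1")
        case True
        then have "norm z \<le> sqrt x \<Longrightarrow> norm z < 1" for z :: complex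
          by (smt (verit) real_sqrt_lt_1_iff)
        then have "S = cball 0 (sqrt x)" unfolding S_def by (auto simp: n)
        then show ?thesis using False True
          by (simp add: y_def emeasure_cball unit_ball_vol_2)
      next
        case x1: False
        then have "norm z < 1 \<Longrightarrow> norm z \<le> sqrt x" for z :: complex
          by (smt (verit) real_sqrt_ge_1_iff)
        then have "S = \<bbbD>" unfolding S_def by (auto simp: n)
        then show ?thesis using x1 emeasure_lebesgue_disk[of 1] by (simp add: y_def)
      qed
      then show ?thesis using S y unfolding S_def[symmetric]
        by (simp add: emeasure_disk_measure divide_ennreal)
    qed
    have 2: "emeasure (uniform_measure lborel {0..1::real}) {..x} = ennreal y"
    proof -
      have i: "{0..1::real} \<inter> {..x} = (if x < 0 then {} else {0..y})"
        by (auto simp: y_def)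
      have "emeasure lborel ({0..1::real} \<inter> {..x}) = ennreal y"
        using y unfolding i by (simp add: y_def ennreal_neg)
      then show ?thesis by (subst emeasure_uniform_measure) (simp_all add: divide_ennreal_def)
    qed
    show "cdf (distr disk_measure borel (\<lambda>z. (norm z)\<^sup>2)) x = cdf (uniform_measure lborel {0..1::real}) x"
      unfolding cdf_def measure_def using 1 2 by (simp add: emeasure_distr)
  qed
qed

lemma disk_integral_norm_power: "(LINT z|disk_measure. (norm z) ^ (2 * n)) = 1 / (real n + 1)"
proof -
  have "(LINT z|disk_measure. (norm z) ^ (2 * n)) = (LINT x|distr disk_measure borel (\<lambda>z. (norm z)\<^sup>2). x ^ n)"
    by (subst integral_distr) (simp_all add: power_mult)
  also have "\<dots> = (LINT x|uniform_measure lborel {0..1::real}. x ^ n)"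
    by (simp add: disk_norm_sq_distr)
  also have "\<dots> = (LINT x|lborel. indicator {0..1} x *\<^sub>R x ^ n)"
  proof -
    have ind: "(\<lambda>x. indicator {0..1} x / emeasure lborel {0..1::real}) = (\<lambda>x. ennreal (indicator {0..1} x))"
      by (auto simp: indicator_def fun_eq_iff divide_ennreal_def)
    then show ?thesis
      unfolding uniform_measure_def ind by (subst integral_density) auto
  qed
  also have "\<dots> = 1 / (real n + 1)"
    using integral_power[of 0 1 n] by (simp add: set_lebesgue_integral_def mult.commute)
  finally show ?thesis .
qed

section \<open>Expansions in harmonic monomials\<close>

text \<open>The orthogonal basis of the harmonic Bergman space: \<open>r\<^bsup>\<bar>n\<bar>\<^esup> e\<^sup>i\<^sup>n\<^sup>\<theta>\<close>, see \<open>hmon_polar\<close>.\<close>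
definition hmon :: "int \<Rightarrow> complex \<Rightarrow> complex" where
  "hmon n z = (if n \<ge> 0 then z ^ nat n else cnj z ^ nat (- n))"

text \<open>The reciprocal of the squared norm of the monomial of index \<open>n\<close>, see \<open>hmon_inner\<close>.\<close>
definition wt :: "int \<Rightarrow> real" where
  "wt n = \<bar>real_of_int n\<bar> + 1"

text \<open>Defined by an integral so that it makes sense for every integrable function; the projections below
  are described by these numbers. For a function with an expansion they are the coefficients.\<close>
definition coef :: "int \<Rightarrow> (complex \<Rightarrow> complex) \<Rightarrow> complex" where
  "coef m f = of_real (wt m) * (LINT z|disk_measure. f z * cnj (hmon m z))"

text \<open>Summability over the unordered index set \<open>\<int>\<close> is absolute in \<open>\<complex>\<close>, so it bounds all partial sums
  uniformly on smaller disks.\<close>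
definition expansion :: "(complex \<Rightarrow> complex) \<Rightarrow> (int \<Rightarrow> complex) \<Rightarrow> bool" where
  "expansion f c \<longleftrightarrow> (\<forall>z. z \<notin> \<bbbD> \<longrightarrow> f z = 0) \<and> (\<forall>z\<in>\<bbbD>. ((\<lambda>n. c n * hmon n z) has_sum f z) UNIV)"

definition hpoly :: "int set \<Rightarrow> (int \<Rightarrow> complex) \<Rightarrow> complex \<Rightarrow> complex" where
  "hpoly F c = on_disk (\<lambda>z. \<Sum>n\<in>F. c n * hmon n z)"

lemma wt_pos [simp]: "wt n > 0" "wt n \<noteq> 0" "wt n \<ge> 0" "wt n \<ge> 1"
  by (auto simp: wt_def add_nonneg_eq_0_iff)

lemma norm_hmon: "norm (hmon n z) = norm z ^ nat \<bar>n\<bar>"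
  by (simp add: hmon_def norm_power)

lemma norm_hmon_le: "norm z \<le> 1 \<Longrightarrow> norm (hmon n z) \<le> 1"
  by (simp add: norm_hmon power_le_one)

lemma borel_measurable_cnj [measurable]:
  "f \<in> borel_measurable M \<Longrightarrow> (\<lambda>x. cnj (f x)) \<in> borel_measurable M"
  by (rule measurable_compose[OF _ borel_measurable_continuous_onI]) (auto intro: continuous_intros)

lemma hmon_measurable [measurable]: "hmon n \<in> borel_measurable borel"
proof (rule borel_measurable_continuous_onI)
  show "continuous_on UNIV (hmon n)"
    unfolding hmon_def by (cases "n \<ge> 0") (auto intro: continuous_intros)
qed

lemma hmon_rotate: "hmon n (cis t * z) = cis (of_int n * t) * hmon n z"
proof (cases "n \<ge> 0")
  case True
  then have "cis t ^ nat n = cis (of_int n * t)" by (simp only: Complex.DeMoivre) simp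
  then show ?thesis using True by (simp only: hmon_def power_mult_distrib if_True)
next
  case False
  then have "cis (- t) ^ nat (- n) = cis (of_int n * t)" by (simp only: Complex.DeMoivre) simp
  then show ?thesis using False by (simp only: hmon_def power_mult_distrib complex_cnj_mult cis_cnj if_False)
qed

lemma hmon_times_cnj: "hmon n z * cnj (hmon n z) = of_real (norm z ^ (2 * nat \<bar>n\<bar>))"
  by (simp only: complex_norm_square[symmetric] norm_hmon power_even_eq)

text \<open>All orthogonality relations are instances of this: a function of angular frequency \<open>d \<noteq> 0\<close>
  changes its sign under the rotation by \<open>\<pi> / d\<close>.\<close>
lemma disk_integral_antisymmetric:
  fixes f :: "complex \<Rightarrow> complex"
  assumes f: "f \<in> borel_measurable disk_measure" and u: "norm u = 1"
    and anti: "AE z in disk_measure. f (u * z) = - f z"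
  shows "(LINT z|disk_measure. f z) = 0"
proof -
  have m[measurable]: "(\<lambda>z. u * z) \<in> disk_measure \<rightarrow>\<^sub>M disk_measure"
    using disk_rotation_measurable[OF u] .
  note f[measurable]
  have "(LINT z|disk_measure. f z) = (LINT z|distr disk_measure disk_measure (\<lambda>z. u * z). f z)"
    by (simp only: disk_rotation_distr[OF u])
  also have "\<dots> = (LINT z|disk_measure. f (u * z))"
    using f by (rule integral_distr[rotated]) fact
  also have "\<dots> = (LINT z|disk_measure. - f z)"
    by (rule integral_cong_AE) (use anti in measurable)
  finally have "2 * (LINT z|disk_measure. f z) = 0" by simp
  then show ?thesis by simp
qed

lemma cis_half_turn: "(m::int) \<noteq> 0 \<Longrightarrow> cis (of_int m * (pi / of_int m)) = -1"
  by simp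

lemma AE_disk_rotate:
  assumes u: "norm u = 1" and P: "AE z in disk_measure. P z"
  shows "AE z in disk_measure. P (u * z)"
proof -
  have "AE z in distr disk_measure disk_measure (\<lambda>z. u * z). P z"
    using P unfolding disk_rotation_distr[OF u] .
  then show ?thesis
    using disk_rotation_measurable[OF u] by (rule AE_distrD[rotated])
qed

lemma AE_in_disk: "(\<And>z. z \<in> \<bbbD> \<Longrightarrow> P z) \<Longrightarrow> AE z in disk_measure. P z"
  by (rule AE_I2) simp

lemma integrable_bounded_times:
  fixes f g :: "complex \<Rightarrow> complex"
  assumes f: "integrable disk_measure f" and g: "g \<in> borel_measurable disk_measure"
    and b: "\<And>z. z \<in> \<bbbD> \<Longrightarrow> norm (g z) \<le> B"
  shows "integrable disk_measure (\<lambda>z. f z * g z)"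
proof (rule Bochner_Integration.integrable_bound)
  show "integrable disk_measure (\<lambda>z. of_real B * f z)" using f by simp
  show "(\<lambda>z. f z * g z) \<in> borel_measurable disk_measure"
    using f g by measurable
  show "AE z in disk_measure. norm (f z * g z) \<le> norm (of_real B * f z)"
  proof (rule AE_in_disk)
    fix z assume z: "z \<in> \<bbbD>"
    then have "norm (g z) \<le> \<bar>B\<bar>" using b[OF z] by linarith
    then show "norm (f z * g z) \<le> norm (of_real B * f z)"
      using mult_left_mono[of "norm (g z)" "\<bar>B\<bar>" "norm (f z)"] by (simp add: norm_mult mult.commute)
  qed
qed

lemma hmon_disk_measurable [measurable]: "hmon n \<in> borel_measurable disk_measure"
  by (rule disk_measurable_borel) (rule hmon_measurable)

lemma integrable_cnj_hmon:
  assumes "integrable disk_measure f"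
  shows "integrable disk_measure (\<lambda>z. f z * cnj (hmon n z))"
  by (rule integrable_bounded_times[OF assms, where B=1]) (auto intro!: norm_hmon_le)

lemma integrable_hmon: "integrable disk_measure (hmon n)"
  by (rule disk.integrable_const_bound[where B=1]) (auto intro!: AE_in_disk norm_hmon_le)

lemma radial_hmon_orthogonal:
  fixes g :: "real \<Rightarrow> complex"
  assumes g: "(\<lambda>z. g (norm z)) \<in> borel_measurable disk_measure" and nm: "n \<noteq> m"
  shows "(LINT z|disk_measure. g (norm z) * (hmon n z * cnj (hmon m z))) = 0"
proof (rule disk_integral_antisymmetric)
  define t where "t = pi / of_int (n - m)"
  show "norm (cis t) = 1" by simp
  show "(\<lambda>z. g (norm z) * (hmon n z * cnj (hmon m z))) \<in> borel_measurable disk_measure"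
    using g by measurable
  have "cis (of_int n * t) * cis (- (of_int m * t)) = -1"
    using nm cis_half_turn[of "n - m"] by (simp add: cis_mult t_def algebra_simps diff_divide_distrib)
  then have e: "cis (of_int n * t) * cnj (cis (of_int m * t)) = -1" by (simp add: cis_cnj)
  show "AE z in disk_measure. g (norm (cis t * z)) * (hmon n (cis t * z) * cnj (hmon m (cis t * z)))
      = - (g (norm z) * (hmon n z * cnj (hmon m z)))"
  proof (rule AE_I2)
    fix z
    have "hmon n (cis t * z) * cnj (hmon m (cis t * z))
        = (cis (of_int n * t) * cnj (cis (of_int m * t))) * (hmon n z * cnj (hmon m z))"
      unfolding hmon_rotate complex_cnj_mult by (simp only: mult_ac)
    then show "g (norm (cis t * z)) * (hmon n (cis t * z) * cnj (hmon m (cis t * z)))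
      = - (g (norm z) * (hmon n z * cnj (hmon m z)))"
      unfolding e by (simp add: norm_mult)
  qed
qed

lemma hmon_inner:
  "(LINT z|disk_measure. hmon n z * cnj (hmon m z)) = (if n = m then 1 / of_real (wt n) else 0)"
proof (cases "n = m")
  case True
  have "(LINT z|disk_measure. hmon n z * cnj (hmon n z))
      = of_real (LINT z|disk_measure. norm z ^ (2 * nat \<bar>n\<bar>))"
    unfolding hmon_times_cnj by (rule integral_complex_of_real)
  also have "\<dots> = 1 / of_real (wt n)"
    by (simp add: disk_integral_norm_power wt_def)
  finally show ?thesis using True by simp
next
  case False
  then show ?thesis using radial_hmon_orthogonal[of "\<lambda>_. 1" n m] by simp
qed

lemma has_sum_symmetric_partial:
  assumes "(g has_sum a) (UNIV :: int set)"
  shows "(\<lambda>N. \<Sum>n\<in>{- int N..int N}. g n) \<longlonglongrightarrow> a"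
proof -
  have "filterlim (\<lambda>N. {- int N..int N}) (finite_subsets_at_top UNIV) sequentially"
    unfolding filterlim_finite_subsets_at_top
  proof (intro allI impI)
    fix X :: "int set" assume X: "finite X \<and> X \<subseteq> UNIV"
    define K where "K = nat (Max (insert 0 (abs ` X)))"
    have "X \<subseteq> {- int N..int N}" if "N \<ge> K" for N
    proof
      fix x assume "x \<in> X"
      then have "\<bar>x\<bar> \<le> Max (insert 0 (abs ` X))" using X by simp
      then show "x \<in> {- int N..int N}" using that unfolding K_def by auto
    qed
    then show "\<forall>\<^sub>F N in sequentially. finite {- int N..int N} \<and> X \<subseteq> {- int N..int N} \<and> {- int N..int N} \<subseteq> UNIV"
      by (auto simp: eventually_sequentially)
  qed
  with assms show ?thesis
    unfolding has_sum_def by (rule filterlim_compose)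
qed

lemma expansion_partial_sums:
  assumes "expansion f c" "z \<in> \<bbbD>"
  shows "(\<lambda>N. \<Sum>n\<in>{- int N..int N}. c n * hmon n z) \<longlonglongrightarrow> f z"
  using assms has_sum_symmetric_partial unfolding expansion_def by blast

text \<open>The absolute sum at the point \<open>r\<close> dominates the partial sums at every point of modulus at most \<open>r\<close>.\<close>
lemma expansion_bound:
  assumes "expansion f c" "0 \<le> r" "r < 1"
  obtains B where "\<And>F z. finite F \<Longrightarrow> norm z \<le> r \<Longrightarrow> norm (\<Sum>n\<in>F. c n * hmon n z) \<le> B"
proof -
  have "(\<lambda>n. c n * hmon n (of_real r)) summable_on UNIV"
    using assms unfolding expansion_def summable_on_def by force
  then have s: "(\<lambda>n. norm (c n * hmon n (of_real r))) summable_on UNIV"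
    by (simp add: summable_on_iff_abs_summable_on_complex)
  have "norm (\<Sum>n\<in>F. c n * hmon n z) \<le> (\<Sum>\<^sub>\<infinity>n. norm (c n * hmon n (of_real r)))"
    if "finite F" "norm z \<le> r" for F z
  proof -
    have "norm (\<Sum>n\<in>F. c n * hmon n z) \<le> (\<Sum>n\<in>F. norm (c n * hmon n (of_real r)))"
      using that assms
      by (intro sum_norm_le) (auto simp: norm_mult norm_hmon intro!: mult_left_mono power_mono)
    also have "\<dots> \<le> (\<Sum>\<^sub>\<infinity>n. norm (c n * hmon n (of_real r)))"
      using that s by (intro finite_sum_le_infsum) auto
    finally show ?thesis .
  qed
  then show ?thesis using that by blast
qed

lemma expansion_measurable [measurable_dest]:
  assumes "expansion f c"
  shows "f \<in> borel_measurable disk_measure"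
  by (rule borel_measurable_LIMSEQ_metric[of "\<lambda>N z. \<Sum>n\<in>{- int N..int N}. c n * hmon n z"])
     (use expansion_partial_sums[OF assms] in \<open>auto\<close>)

text \<open>Termwise integration is justified on the disks of radius \<open>r < 1\<close>, where the partial sums are
  bounded; there orthogonality persists because the cut-off is radial. Dominated convergence for
  \<open>r \<longlonglongrightarrow> 1\<close> gives the claim, with the weight as the normalising factor.\<close>
lemma expansion_coef:
  assumes e: "expansion f c" and f: "integrable disk_measure f"
  shows "coef m f = c m"
proof -
  have fm[measurable]: "f \<in> borel_measurable disk_measure" using f by auto
  define g :: "real \<Rightarrow> real \<Rightarrow> complex" where "g r x = (if x < r then 1 else 0)" for r x
  have gm[measurable]: "(\<lambda>z::complex. g r (norm z)) \<in> borel_measurable disk_measure" for r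
    unfolding g_def by measurable
  have ig: "integrable disk_measure (\<lambda>z. g r (norm z) * (hmon n z * cnj (hmon m z)))" for r n
  proof (rule disk.integrable_const_bound[where B=1])
    show "AE z in disk_measure. norm (g r (norm z) * (hmon n z * cnj (hmon m z))) \<le> 1"
      by (rule AE_in_disk) (auto simp: g_def norm_mult intro!: mult_le_one norm_hmon_le)
  qed measurable
  \<comment> \<open>integrating the expansion over the disk of radius \<^term>\<open>r\<close>\<close>
  have trunc: "(LINT z|disk_measure. g r (norm z) * (f z * cnj (hmon m z)))
      = c m * (LINT z|disk_measure. g r (norm z) * (hmon m z * cnj (hmon m z)))"
    if r: "0 \<le> r" "r < 1" for r
  proof -
    define s where "s N z = g r (norm z) * ((\<Sum>n\<in>{- int N..int N}. c n * hmon n z) * cnj (hmon m z))" for N z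
    obtain B where B: "\<And>F z. finite F \<Longrightarrow> norm z \<le> r \<Longrightarrow> norm (\<Sum>n\<in>F. c n * hmon n z) \<le> B"
      using expansion_bound[OF e r] by blast
    have B0: "B \<ge> 0" using B[of "{}" 0] r by simp
    have "(\<lambda>N. LINT z|disk_measure. s N z) \<longlonglongrightarrow> (LINT z|disk_measure. g r (norm z) * (f z * cnj (hmon m z)))"
    proof (rule integral_dominated_convergence[where w = "\<lambda>_. B"])
      show "AE z in disk_measure. (\<lambda>N. s N z) \<longlonglongrightarrow> g r (norm z) * (f z * cnj (hmon m z))"
        unfolding s_def by (intro AE_in_disk tendsto_intros expansion_partial_sums[OF e])
      show "AE z in disk_measure. norm (s N z) \<le> B" for N
      proof (rule AE_in_disk)
        fix z :: complex assume z: "z \<in> \<bbbD>"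
        show "norm (s N z) \<le> B"
        proof (cases "norm z < r")
          case True
          then show ?thesis
            using z B0 B[of "{- int N..int N}" z] norm_hmon_le[of z m]
              mult_mono[of "norm (\<Sum>n\<in>{- int N..int N}. c n * hmon n z)" B "norm (hmon m z)" 1]
            by (simp add: s_def g_def norm_mult)
        qed (use B0 in \<open>auto simp: s_def g_def\<close>)
      qed
      show "s N \<in> borel_measurable disk_measure" for N
        unfolding s_def by measurable
    qed auto
    moreover have "(LINT z|disk_measure. s N z)
        = c m * (LINT z|disk_measure. g r (norm z) * (hmon m z * cnj (hmon m z)))" if "N \<ge> nat \<bar>m\<bar>" for N
    proof -
      have "(LINT z|disk_measure. s N z)
          = (LINT z|disk_measure. (\<Sum>n\<in>{- int N..int N}. c n * (g r (norm z) * (hmon n z * cnj (hmon m z)))))"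
        unfolding s_def by (simp add: sum_distrib_left sum_distrib_right mult_ac)
      also have "\<dots> = (\<Sum>n\<in>{- int N..int N}. c n * (LINT z|disk_measure. g r (norm z) * (hmon n z * cnj (hmon m z))))"
        using ig by (subst Bochner_Integration.integral_sum) auto
      also have "\<dots> = (\<Sum>n\<in>{- int N..int N}. if n = m then c m * (LINT z|disk_measure. g r (norm z) * (hmon m z * cnj (hmon m z))) else 0)"
        by (rule sum.cong) (auto simp: radial_hmon_orthogonal[OF gm])
      also have "\<dots> = c m * (LINT z|disk_measure. g r (norm z) * (hmon m z * cnj (hmon m z)))"
        using that by (subst sum.delta) auto
      finally show ?thesis .
    qed
    then have "(\<lambda>N. LINT z|disk_measure. s N z) \<longlonglongrightarrow> c m * (LINT z|disk_measure. g r (norm z) * (hmon m z * cnj (hmon m z)))"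
      by (intro tendsto_eventually) (auto simp: eventually_sequentially)
    ultimately show ?thesis by (rule LIMSEQ_unique)
  qed
  define r :: "nat \<Rightarrow> real" where "r j = 1 - 1 / real (Suc j)" for j
  have r: "0 \<le> r j" "r j < 1" for j by (auto simp: r_def field_simps)
  have rlim: "r \<longlonglongrightarrow> 1"
    unfolding r_def using tendsto_diff[OF tendsto_const[of 1] LIMSEQ_Suc[OF lim_1_over_n]] by simp
  have lim: "(\<lambda>j. LINT z|disk_measure. g (r j) (norm z) * h z) \<longlonglongrightarrow> (LINT z|disk_measure. h z)"
    if h: "integrable disk_measure h" for h :: "complex \<Rightarrow> complex"
  proof (rule integral_dominated_convergence[where w = "\<lambda>z. norm (h z)"])
    show "AE z in disk_measure. (\<lambda>j. g (r j) (norm z) * h z) \<longlonglongrightarrow> h z"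
    proof (rule AE_in_disk)
      fix z :: complex assume "z \<in> \<bbbD>"
      then have "\<forall>\<^sub>F j in sequentially. norm z < r j"
        using order_tendstoD(1)[OF rlim] by simp
      then show "(\<lambda>j. g (r j) (norm z) * h z) \<longlonglongrightarrow> h z"
        by (intro tendsto_eventually) (auto elim!: eventually_mono simp: g_def)
    qed
    show "AE z in disk_measure. norm (g (r j) (norm z) * h z) \<le> norm (h z)" for j
      by (rule AE_I2) (auto simp: g_def)
    show "h \<in> borel_measurable disk_measure" using h by auto
    then show "(\<lambda>z. g (r j) (norm z) * h z) \<in> borel_measurable disk_measure" for j
      by measurable
    show "integrable disk_measure (\<lambda>z. norm (h z))" using h by simp
  qed
  have "(\<lambda>j. c m * (LINT z|disk_measure. g (r j) (norm z) * (hmon m z * cnj (hmon m z))))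
      \<longlonglongrightarrow> (LINT z|disk_measure. f z * cnj (hmon m z))"
    using lim[OF integrable_cnj_hmon[OF f, of m]] trunc[OF r] by simp
  moreover have "(\<lambda>j. c m * (LINT z|disk_measure. g (r j) (norm z) * (hmon m z * cnj (hmon m z))))
      \<longlonglongrightarrow> c m * (LINT z|disk_measure. hmon m z * cnj (hmon m z))"
    by (intro tendsto_intros lim integrable_cnj_hmon integrable_hmon)
  ultimately have "(LINT z|disk_measure. f z * cnj (hmon m z))
      = c m * (LINT z|disk_measure. hmon m z * cnj (hmon m z))"
    by (rule LIMSEQ_unique)
  then show ?thesis by (simp add: coef_def hmon_inner)
qed

section \<open>Bessel's inequality and its converse\<close>

lemma hpoly_in_disk: "z \<in> \<bbbD> \<Longrightarrow> hpoly F c z = (\<Sum>n\<in>F. c n * hmon n z)"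
  by (simp add: hpoly_def on_disk_def)

lemma hpoly_expansion:
  assumes "finite F"
  shows "expansion (hpoly F c) (\<lambda>n. if n \<in> F then c n else 0)"
  unfolding expansion_def
proof (intro conjI allI impI ballI)
  fix z :: complex assume z: "z \<in> \<bbbD>"
  have "((\<lambda>n. c n * hmon n z) has_sum hpoly F c z) F"
    using has_sum_finite[OF assms, of "\<lambda>n. c n * hmon n z"] z by (simp add: hpoly_in_disk)
  then show "((\<lambda>n. (if n \<in> F then c n else 0) * hmon n z) has_sum hpoly F c z) UNIV"
    by (rule iffD1[OF has_sum_cong_neutral, rotated -1]) auto
qed (simp add: hpoly_def on_disk_def)

lemma L2_norm_disk_sq: "(L2_norm_disk f)\<^sup>2 = (LINT z|disk_measure. (norm (f z))\<^sup>2)"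
  unfolding L2_norm_disk_def by (rule real_sqrt_pow2) simp

lemma L2_norm_disk_nonneg [simp]: "L2_norm_disk f \<ge> 0"
  unfolding L2_norm_disk_def by simp

lemma square_integrable_integrable:
  assumes "square_integrable f" shows "integrable disk_measure f"
proof (rule Bochner_Integration.integrable_bound)
  show "integrable disk_measure (\<lambda>z. 1 + (norm (f z))\<^sup>2)"
    using assms by (simp add: square_integrable_def)
  show "AE z in disk_measure. norm (f z) \<le> norm (1 + (norm (f z))\<^sup>2)"
  proof (rule AE_I2)
    fix z have "0 \<le> (norm (f z) - 1)\<^sup>2" by simp
    then have "norm (f z) \<le> 1 + (norm (f z))\<^sup>2"
      using norm_ge_zero[of "f z"] by (simp add: power2_diff) (smt (verit) zero_le_power2)
    then show "norm (f z) \<le> norm (1 + (norm (f z))\<^sup>2)" by simp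
  qed
qed (use assms in \<open>simp add: square_integrable_def\<close>)

lemma square_integrable_mult:
  assumes "square_integrable f" "square_integrable g"
  shows "integrable disk_measure (\<lambda>z. f z * cnj (g z))"
proof (rule Bochner_Integration.integrable_bound)
  have [measurable]: "f \<in> borel_measurable disk_measure" "g \<in> borel_measurable disk_measure"
    using assms by (auto simp: square_integrable_def)
  show "(\<lambda>z. f z * cnj (g z)) \<in> borel_measurable disk_measure" by measurable
  show "integrable disk_measure (\<lambda>z. (norm (f z))\<^sup>2 + (norm (g z))\<^sup>2)"
    using assms by (simp add: square_integrable_def)
  show "AE z in disk_measure. norm (f z * cnj (g z)) \<le> norm ((norm (f z))\<^sup>2 + (norm (g z))\<^sup>2)"
  proof (rule AE_I2)
    fix z
    have "2 * norm (f z) * norm (g z) \<le> (norm (f z))\<^sup>2 + (norm (g z))\<^sup>2"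
      by (rule sum_squares_bound)
    moreover have "0 \<le> norm (f z) * norm (g z)" by simp
    ultimately have "norm (f z) * norm (g z) \<le> (norm (f z))\<^sup>2 + (norm (g z))\<^sup>2" by linarith
    then show "norm (f z * cnj (g z)) \<le> norm ((norm (f z))\<^sup>2 + (norm (g z))\<^sup>2)"
      by (simp add: norm_mult)
  qed
qed

lemma square_integrable_scale:
  "square_integrable f \<Longrightarrow> square_integrable (\<lambda>z. a * f z)"
  unfolding square_integrable_def by (auto simp: norm_mult power_mult_distrib)

lemma square_integrable_add:
  assumes f: "square_integrable f" and g: "square_integrable g"
  shows "square_integrable (\<lambda>z. f z + g z)"
  unfolding square_integrable_def
proof
  have [measurable]: "f \<in> borel_measurable disk_measure" "g \<in> borel_measurable disk_measure"
    using assms by (auto simp: square_integrable_def)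
  show "(\<lambda>z. f z + g z) \<in> borel_measurable disk_measure" by measurable
  show "integrable disk_measure (\<lambda>z. (norm (f z + g z))\<^sup>2)"
  proof (rule Bochner_Integration.integrable_bound)
    show "integrable disk_measure (\<lambda>z. 2 * (norm (f z))\<^sup>2 + 2 * (norm (g z))\<^sup>2)"
      using assms by (simp add: square_integrable_def)
    show "AE z in disk_measure. norm ((norm (f z + g z))\<^sup>2) \<le> norm (2 * (norm (f z))\<^sup>2 + 2 * (norm (g z))\<^sup>2)"
    proof (rule AE_I2)
      fix z
      have "(norm (f z + g z))\<^sup>2 \<le> (norm (f z) + norm (g z))\<^sup>2"
        by (intro power_mono norm_triangle_ineq) simp
      also have "\<dots> \<le> 2 * (norm (f z))\<^sup>2 + 2 * (norm (g z))\<^sup>2"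
        using sum_squares_bound[of "norm (f z)" "norm (g z)"] by (simp add: power2_sum)
      finally show "norm ((norm (f z + g z))\<^sup>2) \<le> norm (2 * (norm (f z))\<^sup>2 + 2 * (norm (g z))\<^sup>2)"
        by simp
    qed
  qed measurable
qed

lemma hpoly_square_integrable: "finite F \<Longrightarrow> square_integrable (hpoly F c)"
proof -
  assume F: "finite F"
  have m[measurable]: "hpoly F c \<in> borel_measurable disk_measure"
    using expansion_measurable[OF hpoly_expansion[OF F]] .
  obtain B where B: "\<And>z. z \<in> \<bbbD> \<Longrightarrow> norm (hpoly F c z) \<le> B"
  proof
    fix z :: complex assume z: "z \<in> \<bbbD>"
    show "norm (hpoly F c z) \<le> (\<Sum>n\<in>F. norm (c n))"
      unfolding hpoly_in_disk[OF z] using z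
      by (intro sum_norm_le) (auto simp: norm_mult intro!: mult_left_le norm_hmon_le)
  qed
  have "integrable disk_measure (\<lambda>z. (norm (hpoly F c z))\<^sup>2)"
    by (rule disk.integrable_const_bound[where B = "B\<^sup>2"]) (auto intro!: AE_in_disk power_mono B)
  then show ?thesis using m by (simp add: square_integrable_def)
qed

lemma coef_integral: "(LINT z|disk_measure. f z * cnj (hmon m z)) = coef m f / of_real (wt m)"
  by (simp add: coef_def)

lemma integral_times_cnj_hpoly:
  assumes f: "integrable disk_measure f" and F: "finite F"
  shows "(LINT z|disk_measure. f z * cnj (hpoly F c z)) = (\<Sum>n\<in>F. cnj (c n) * coef n f / of_real (wt n))"
proof -
  have "(LINT z|disk_measure. f z * cnj (hpoly F c z))
      = (LINT z|disk_measure. (\<Sum>n\<in>F. cnj (c n) * (f z * cnj (hmon n z))))"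
    by (rule Bochner_Integration.integral_cong)
       (auto simp: hpoly_in_disk sum_distrib_left mult_ac)
  also have "\<dots> = (\<Sum>n\<in>F. cnj (c n) * (LINT z|disk_measure. f z * cnj (hmon n z)))"
    using integrable_cnj_hmon[OF f] by (subst Bochner_Integration.integral_sum) auto
  finally show ?thesis by (simp add: coef_integral)
qed

lemma coef_hpoly: "finite F \<Longrightarrow> coef n (hpoly F c) = (if n \<in> F then c n else 0)"
  by (rule expansion_coef[OF hpoly_expansion square_integrable_integrable[OF hpoly_square_integrable]])

lemma integral_norm_sq_complex:
  "of_real (LINT z|disk_measure. (norm (f z))\<^sup>2) = (LINT z|disk_measure. f z * cnj (f z))"
  by (simp only: integral_complex_of_real[symmetric] complex_norm_square)

lemma norm_hpoly:
  assumes F: "finite F"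
  shows "(L2_norm_disk (hpoly F c))\<^sup>2 = (\<Sum>n\<in>F. (norm (c n))\<^sup>2 / wt n)"
proof -
  have "complex_of_real ((L2_norm_disk (hpoly F c))\<^sup>2) = (\<Sum>n\<in>F. cnj (c n) * coef n (hpoly F c) / of_real (wt n))"
    unfolding L2_norm_disk_sq integral_norm_sq_complex
    by (rule integral_times_cnj_hpoly[OF square_integrable_integrable[OF hpoly_square_integrable[OF F]] F])
  also have "\<dots> = (\<Sum>n\<in>F. of_real ((norm (c n))\<^sup>2 / wt n))"
    by (rule sum.cong) (simp_all only: coef_hpoly[OF F] if_True mult.commute[of "cnj _"] of_real_divide complex_norm_square)
  finally show ?thesis by (simp only: of_real_sum[symmetric] of_real_eq_iff)
qed

text \<open>The squared norm of \<open>f\<close> minus its partial sum over \<open>F\<close> is nonnegative, and it is the difference of the two sides.\<close>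
lemma bessel_inequality:
  assumes f: "square_integrable f" and F: "finite F"
  shows "(\<Sum>n\<in>F. (norm (coef n f))\<^sup>2 / wt n) \<le> (L2_norm_disk f)\<^sup>2"
proof -
  define s where "s = hpoly F (\<lambda>n. coef n f)"
  define E where "E = (\<Sum>n\<in>F. (norm (coef n f))\<^sup>2 / wt n)"
  have s: "square_integrable s" unfolding s_def by (rule hpoly_square_integrable[OF F])
  have fs: "(LINT z|disk_measure. f z * cnj (s z)) = of_real E"
  proof -
    have "(LINT z|disk_measure. f z * cnj (s z)) = (\<Sum>n\<in>F. cnj (coef n f) * coef n f / of_real (wt n))"
      unfolding s_def by (rule integral_times_cnj_hpoly[OF square_integrable_integrable[OF f] F])
    also have "\<dots> = (\<Sum>n\<in>F. of_real ((norm (coef n f))\<^sup>2 / wt n))"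
      by (rule sum.cong) (simp_all only: mult.commute[of "cnj _"] of_real_divide complex_norm_square)
    finally show ?thesis unfolding E_def of_real_sum .
  qed
  then have sf: "(LINT z|disk_measure. s z * cnj (f z)) = of_real E"
    using Bochner_Integration.integral_cnj[of disk_measure "\<lambda>z. f z * cnj (s z)"] by (simp add: mult.commute)
  have ss: "(LINT z|disk_measure. s z * cnj (s z)) = of_real E"
    using norm_hpoly[OF F, of "\<lambda>n. coef n f"]
    unfolding L2_norm_disk_sq integral_norm_sq_complex[symmetric] s_def E_def by simp
  have "of_real (LINT z|disk_measure. (norm (f z - s z))\<^sup>2)
      = (LINT z|disk_measure. f z * cnj (f z) - f z * cnj (s z) - (s z * cnj (f z) - s z * cnj (s z)))"
    unfolding integral_norm_sq_complex by (simp add: algebra_simps)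
  also have "\<dots> = (LINT z|disk_measure. f z * cnj (f z)) - (LINT z|disk_measure. f z * cnj (s z))
      - ((LINT z|disk_measure. s z * cnj (f z)) - (LINT z|disk_measure. s z * cnj (s z)))"
    using f s by (simp add: square_integrable_mult Bochner_Integration.integral_diff)
  also have "\<dots> = of_real ((L2_norm_disk f)\<^sup>2 - E)"
    unfolding fs sf ss integral_norm_sq_complex[symmetric] L2_norm_disk_sq by simp
  finally have "(LINT z|disk_measure. (norm (f z - s z))\<^sup>2) = (L2_norm_disk f)\<^sup>2 - E"
    by (simp only: of_real_eq_iff)
  moreover have "(LINT z|disk_measure. (norm (f z - s z))\<^sup>2) \<ge> 0" by simp
  ultimately show ?thesis unfolding E_def by linarith
qed

lemma coef_le_norm:
  assumes "square_integrable f" shows "(norm (coef n f))\<^sup>2 \<le> wt n * (L2_norm_disk f)\<^sup>2"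
  using bessel_inequality[OF assms, of "{n}"] by (simp add: field_simps)

text \<open>Converse of Bessel's inequality, by Fatou's lemma along the symmetric partial sums. Together the
  two give the norm in terms of the coefficients without an exact Parseval identity.\<close>
lemma expansion_norm_le:
  assumes e: "expansion f c"
    and M: "\<And>F. finite F \<Longrightarrow> (\<Sum>n\<in>F. (norm (c n))\<^sup>2 / wt n) \<le> M"
  shows "square_integrable f" "(L2_norm_disk f)\<^sup>2 \<le> M"
proof -
  have fm[measurable]: "f \<in> borel_measurable disk_measure" using expansion_measurable[OF e] .
  define s where "s N = hpoly {- int N..int N} c" for N
  have sm[measurable]: "s N \<in> borel_measurable disk_measure" for N
    unfolding s_def using hpoly_square_integrable[of "{- int N..int N}" c] by (simp add: square_integrable_def)
  have M0: "M \<ge> 0" using M[of "{}"] by simp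
  have lim: "(\<lambda>N. s N z) \<longlonglongrightarrow> f z" if "z \<in> \<bbbD>" for z
    unfolding s_def hpoly_in_disk[OF that] by (rule expansion_partial_sums[OF e that])
  have snorm: "(\<integral>\<^sup>+z. ennreal ((norm (s N z))\<^sup>2) \<partial>disk_measure) \<le> ennreal M" for N
  proof -
    have "(\<integral>\<^sup>+z. ennreal ((norm (s N z))\<^sup>2) \<partial>disk_measure) = ennreal ((L2_norm_disk (s N))\<^sup>2)"
      unfolding L2_norm_disk_sq s_def using hpoly_square_integrable[of "{- int N..int N}" c]
      by (intro nn_integral_eq_integral) (auto simp: square_integrable_def)
    also have "\<dots> \<le> ennreal M"
      unfolding s_def by (subst norm_hpoly) (auto intro!: M ennreal_leI)
    finally show ?thesis .
  qed
  have "(\<integral>\<^sup>+z. ennreal ((norm (f z))\<^sup>2) \<partial>disk_measure)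
      = (\<integral>\<^sup>+z. liminf (\<lambda>N. ennreal ((norm (s N z))\<^sup>2)) \<partial>disk_measure)"
  proof (rule nn_integral_cong)
    fix z assume "z \<in> space disk_measure"
    then have "(\<lambda>N. ennreal ((norm (s N z))\<^sup>2)) \<longlonglongrightarrow> ennreal ((norm (f z))\<^sup>2)"
      by (intro tendsto_ennrealI tendsto_intros lim) simp
    then show "ennreal ((norm (f z))\<^sup>2) = liminf (\<lambda>N. ennreal ((norm (s N z))\<^sup>2))"
      by (rule lim_imp_Liminf[OF sequentially_bot, symmetric])
  qed
  also have "\<dots> \<le> liminf (\<lambda>N. \<integral>\<^sup>+z. ennreal ((norm (s N z))\<^sup>2) \<partial>disk_measure)"
    by (rule nn_integral_liminf) measurable
  also have "\<dots> \<le> ennreal M"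
    by (rule Liminf_le) (use snorm in \<open>simp_all add: always_eventually\<close>)
  finally have le: "(\<integral>\<^sup>+z. ennreal ((norm (f z))\<^sup>2) \<partial>disk_measure) \<le> ennreal M" .
  show sq: "square_integrable f"
    unfolding square_integrable_def using le fm
    by (auto intro!: integrableI_bounded intro: le_less_trans)
  have "ennreal ((L2_norm_disk f)\<^sup>2) = (\<integral>\<^sup>+z. ennreal ((norm (f z))\<^sup>2) \<partial>disk_measure)"
    unfolding L2_norm_disk_sq using sq
    by (intro nn_integral_eq_integral[symmetric]) (auto simp: square_integrable_def)
  with le have "ennreal ((L2_norm_disk f)\<^sup>2) \<le> ennreal M" by (simp only:)
  then show "(L2_norm_disk f)\<^sup>2 \<le> M" using ennreal_le_iff[OF M0] by blast
qed

lemma expansion_unique: "expansion f c \<Longrightarrow> expansion g c \<Longrightarrow> f = g"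
  unfolding expansion_def fun_eq_iff by (metis has_sum_unique)

lemma expansion_add: "expansion f c \<Longrightarrow> expansion g d \<Longrightarrow> expansion (\<lambda>z. f z + g z) (\<lambda>n. c n + d n)"
  unfolding expansion_def by (auto simp: distrib_right intro!: has_sum_add)

lemma expansion_scale: "expansion f c \<Longrightarrow> expansion (\<lambda>z. a * f z) (\<lambda>n. a * c n)"
  unfolding expansion_def by (auto simp: mult.assoc intro!: has_sum_cmult_right)

lemma coef_add:
  assumes "integrable disk_measure f" "integrable disk_measure g"
  shows "coef n (\<lambda>z. f z + g z) = coef n f + coef n g"
  unfolding coef_def using integrable_cnj_hmon[OF assms(1), of n] integrable_cnj_hmon[OF assms(2), of n]
  by (simp add: distrib_right distrib_left)

lemma coef_scale: "coef n (\<lambda>z. a * f z) = a * coef n f"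
  unfolding coef_def by (simp add: mult.assoc)

lemma coef_diff:
  assumes "integrable disk_measure f" "integrable disk_measure g"
  shows "coef n (\<lambda>z. f z - g z) = coef n f - coef n g"
  using coef_add[OF assms(1), of "\<lambda>z. (-1) * g z" n] assms(2) coef_scale[of n "-1" g] by simp

section \<open>The projections and the Bergman spaces in coordinates\<close>

text \<open>The enumeration \<open>- n - 1\<close> of the negative indices matches the shift by one in the
  conjugate part of the harmonic kernel, where the constant term is counted only once.\<close>
lemma has_sum_int:
  fixes f :: "int \<Rightarrow> 'a::{banach}"
  assumes pos: "((\<lambda>n::nat. f (int n)) has_sum a) UNIV"
    and neg: "((\<lambda>n::nat. f (- int n - 1)) has_sum b) UNIV"
  shows "(f has_sum (a + b)) UNIV"
proof -
  have 1: "(f has_sum a) (range int)"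
    using pos by (subst has_sum_reindex) (auto simp: o_def)
  have 2: "(f has_sum b) (range (\<lambda>n::nat. - int n - 1))"
    using neg by (subst has_sum_reindex) (auto simp: o_def inj_on_def)
  have "(f has_sum (a + b)) (range int \<union> range (\<lambda>n::nat. - int n - 1))"
    by (rule has_sum_Un_disjoint[OF 1 2]) auto
  moreover have "range int \<union> range (\<lambda>n::nat. - int n - 1) = UNIV"
  proof -
    have "x \<in> range int \<union> range (\<lambda>n::nat. - int n - 1)" for x
    proof (cases "x \<ge> 0")
      case True then show ?thesis by (metis UnI1 nat_0_le rangeI)
    next
      case False
      then have "x = - int (nat (- x - 1)) - 1" by simp
      then show ?thesis by blast
    qed
    then show ?thesis by blast
  qed
  ultimately show ?thesis by simp
qed

lemma norm_summable_weighted_powers: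
  assumes "norm (x::complex) < 1"
  shows "summable (\<lambda>n. norm (of_nat (Suc n) * x ^ n))"
  using sums_summable[OF geometric_deriv_sums[of "norm x"]] assms by (simp add: norm_mult norm_power del: of_nat_Suc)

lemma has_sum_weighted_powers:
  assumes "norm (x::complex) < 1"
  shows "((\<lambda>n. of_nat (Suc n) * x ^ n) has_sum 1 / (1 - x)\<^sup>2) UNIV"
  by (rule norm_summable_imp_has_sum[OF norm_summable_weighted_powers geometric_deriv_sums]) (use assms in auto)

lemma has_sum_weighted_powers_Suc:
  assumes "norm (x::complex) < 1"
  shows "((\<lambda>n. of_nat (Suc (Suc n)) * x ^ Suc n) has_sum (1 / (1 - x)\<^sup>2 - 1)) UNIV"
proof (rule norm_summable_imp_has_sum)
  show "summable (\<lambda>n. norm (of_nat (Suc (Suc n)) * x ^ Suc n))"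
    using norm_summable_weighted_powers[OF assms]
    by (subst summable_Suc_iff[of "\<lambda>n. norm (of_nat (Suc n) * x ^ n)"])
  show "(\<lambda>n. of_nat (Suc (Suc n)) * x ^ Suc n) sums (1 / (1 - x)\<^sup>2 - 1)"
    using geometric_deriv_sums[OF assms] sums_Suc_iff[of "\<lambda>n. of_nat (Suc n) * x ^ n" "1 / (1 - x)\<^sup>2 - 1"] by simp
qed

lemma wt_int [simp]: "wt (int n) = real (Suc n)" "wt (- int n - 1) = real (Suc (Suc n))"
  by (auto simp: wt_def)

lemma hmon_int: "hmon (int n) z = z ^ n" "hmon (- int n - 1) z = cnj z ^ Suc n"
  by (auto simp: hmon_def nat_add_distrib)

lemma bergman_kernel_has_sum:
  assumes "z \<in> \<bbbD>" "w \<in> \<bbbD>"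
  shows "((\<lambda>n. if n \<in> {0..} then of_real (wt n) * (hmon n z * cnj (hmon n w)) else 0)
      has_sum 1 / (1 - z * cnj w)\<^sup>2) UNIV"
proof -
  have "norm (z * cnj w) < 1" using assms by (simp add: norm_mult mult_strict_mono' order.strict_trans1[OF mult_left_le])
  from has_sum_weighted_powers[OF this]
  have "((\<lambda>n. if int n \<in> {0..} then of_real (wt (int n)) * (hmon (int n) z * cnj (hmon (int n) w)) else 0)
      has_sum 1 / (1 - z * cnj w)\<^sup>2) UNIV"
    by (simp add: hmon_int power_mult_distrib)
  from has_sum_int[OF this, of 0] show ?thesis by simp
qed

lemma harmonic_kernel_has_sum:
  assumes "z \<in> \<bbbD>" "w \<in> \<bbbD>"
  shows "((\<lambda>n. if n \<in> UNIV then of_real (wt n) * (hmon n z * cnj (hmon n w)) else 0)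
      has_sum (1 / (1 - z * cnj w)\<^sup>2 + 1 / (1 - cnj z * w)\<^sup>2 - 1)) UNIV"
proof -
  have n: "norm (z * cnj w) < 1" "norm (cnj z * w) < 1"
    using assms by (simp_all add: norm_mult order.strict_trans1[OF mult_left_le])
  have p: "((\<lambda>n. of_real (wt (int n)) * (hmon (int n) z * cnj (hmon (int n) w))) has_sum 1 / (1 - z * cnj w)\<^sup>2) UNIV"
    using has_sum_weighted_powers[OF n(1)] by (simp add: hmon_int power_mult_distrib)
  have q: "((\<lambda>n. of_real (wt (- int n - 1)) * (hmon (- int n - 1) z * cnj (hmon (- int n - 1) w)))
      has_sum (1 / (1 - cnj z * w)\<^sup>2 - 1)) UNIV"
    unfolding hmon_int wt_int
    using has_sum_weighted_powers_Suc[OF n(2)] by (simp only: power_mult_distrib complex_cnj_power complex_cnj_cnj of_real_of_nat_eq)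
  show ?thesis
    using has_sum_int[of "\<lambda>n. of_real (wt n) * (hmon n z * cnj (hmon n w))", OF p q]
    by (simp only: UNIV_I if_True add_diff_eq)
qed

lemma wt_power_summable:
  assumes "0 \<le> r" "r < 1"
  shows "(\<lambda>n. wt n * r ^ nat \<bar>n\<bar>) summable_on UNIV"
proof -
  define z :: complex where "z = of_real r"
  have z: "norm z < 1" using assms by (simp add: z_def)
  have r: "wt n * r ^ nat \<bar>n\<bar> = norm (of_real (wt n) * hmon n z)" for n
    using assms by (simp add: norm_mult norm_hmon z_def)
  have "((\<lambda>n. of_real (wt (int n)) * hmon (int n) z) has_sum 1 / (1 - z)\<^sup>2) UNIV"
    using has_sum_weighted_powers[OF z] by (simp add: hmon_int)
  moreover have "((\<lambda>n. of_real (wt (- int n - 1)) * hmon (- int n - 1) z) has_sum (1 / (1 - z)\<^sup>2 - 1)) UNIV"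
    unfolding hmon_int wt_int
    using has_sum_weighted_powers_Suc[OF z] by (simp only: z_def complex_cnj_complex_of_real of_real_of_nat_eq)
  ultimately have "(\<lambda>n. of_real (wt n) * hmon n z) summable_on UNIV"
    using has_sum_int[of "\<lambda>n. of_real (wt n) * hmon n z"] summable_on_def by blast
  then show ?thesis unfolding r by (simp only: summable_on_iff_abs_summable_on_complex)
qed

lemma growth_summable:
  assumes c: "\<And>n. norm (c n) \<le> K * wt n" and z: "z \<in> \<bbbD>"
  shows "(\<lambda>n. c n * hmon n z) summable_on UNIV"
proof -
  have "(\<lambda>n. K * (wt n * norm z ^ nat \<bar>n\<bar>)) summable_on UNIV"
    using wt_power_summable[of "norm z"] z by (intro summable_on_cmult_right) auto
  moreover have "norm (c n * hmon n z) \<le> K * (wt n * norm z ^ nat \<bar>n\<bar>)" for n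
    using mult_right_mono[OF c[of n], of "norm z ^ nat \<bar>n\<bar>"] by (simp add: norm_mult norm_hmon mult.assoc)
  ultimately have "(\<lambda>n. norm (c n * hmon n z)) summable_on UNIV"
    by (rule summable_on_comparison_test) auto
  then show ?thesis by (simp only: summable_on_iff_abs_summable_on_complex)
qed

lemma growth_expansion:
  assumes c: "\<And>n. norm (c n) \<le> K * wt n"
  shows "expansion (on_disk (\<lambda>z. \<Sum>\<^sub>\<infinity>n. c n * hmon n z)) c"
  unfolding expansion_def on_disk_def using growth_summable[OF c] by (auto intro: has_sum_infsum)

lemma coef_growth:
  assumes "integrable disk_measure v"
  shows "norm (coef n v) \<le> (LINT z|disk_measure. norm (v z)) * wt n"
proof -
  have "norm (LINT z|disk_measure. v z * cnj (hmon n z)) \<le> (LINT z|disk_measure. norm (v z * cnj (hmon n z)))"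
    by (rule integral_norm_bound)
  also have "\<dots> \<le> (LINT z|disk_measure. norm (v z))"
    by (rule integral_mono[OF integrable_norm[OF integrable_cnj_hmon[OF assms]] integrable_norm[OF assms]])
      (auto simp: norm_mult intro!: mult_left_le norm_hmon_le)
  finally show ?thesis by (simp add: coef_def norm_mult mult.commute)
qed

text \<open>The partial sums of the kernel are bounded for fixed \<open>z\<close>, so the kernel may be integrated termwise
  against an arbitrary integrable function. A projection therefore keeps the coefficients with index
  in \<open>S\<close> and discards the others.\<close>
lemma kernel_expansion:
  assumes v: "integrable disk_measure v"
    and k: "\<And>z w. z \<in> \<bbbD> \<Longrightarrow> w \<in> \<bbbD> \<Longrightarrow>
      ((\<lambda>n. if n \<in> S then of_real (wt n) * (hmon n z * cnj (hmon n w)) else 0) has_sum k z w) UNIV"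
  shows "expansion (on_disk (\<lambda>z. LINT w|disk_measure. k z w * v w)) (\<lambda>n. if n \<in> S then coef n v else 0)"
    (is "expansion _ ?c")
  unfolding expansion_def
proof (intro conjI allI impI ballI)
  fix z :: complex assume z: "z \<in> \<bbbD>"
  have [measurable]: "v \<in> borel_measurable disk_measure" using v by auto
  define e where "e n w = (if n \<in> S then of_real (wt n) * (hmon n z * cnj (hmon n w)) else 0)" for n w
  define kN where "kN N w = (\<Sum>n\<in>{- int N..int N}. e n w)" for N w
  have e_m[measurable]: "e n \<in> borel_measurable disk_measure" for n
    unfolding e_def by measurable
  have kN_m[measurable]: "kN N \<in> borel_measurable disk_measure" for N
    unfolding kN_def by measurable
  have klim: "(\<lambda>N. kN N w) \<longlonglongrightarrow> k z w" if "w \<in> \<bbbD>" for w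
    unfolding kN_def e_def by (rule has_sum_symmetric_partial[OF k[OF z that]])
  have k_m[measurable]: "k z \<in> borel_measurable disk_measure"
    by (rule borel_measurable_LIMSEQ_metric[of kN]) (auto intro: klim)
  define B where "B = (\<Sum>\<^sub>\<infinity>n. wt n * norm z ^ nat \<bar>n\<bar>)"
  have en: "norm (e n w) \<le> wt n * norm z ^ nat \<bar>n\<bar>" if "w \<in> \<bbbD>" for n w
    using that by (auto simp: e_def norm_mult norm_hmon intro!: mult_left_mono mult_left_le power_le_one)
  have kN_b: "norm (kN N w) \<le> B" if "w \<in> \<bbbD>" for N w
  proof -
    have "norm (kN N w) \<le> (\<Sum>n\<in>{- int N..int N}. wt n * norm z ^ nat \<bar>n\<bar>)"
      unfolding kN_def by (rule sum_norm_le) (rule en[OF that])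
    also have "\<dots> \<le> B"
      unfolding B_def using z by (intro finite_sum_le_infsum wt_power_summable) auto
    finally show ?thesis .
  qed
  have "(\<lambda>N. LINT w|disk_measure. kN N w * v w) \<longlonglongrightarrow> (LINT w|disk_measure. k z w * v w)"
  proof (rule integral_dominated_convergence[where w = "\<lambda>w. B * norm (v w)"])
    show "AE w in disk_measure. (\<lambda>N. kN N w * v w) \<longlonglongrightarrow> k z w * v w"
      by (intro AE_in_disk tendsto_intros klim)
    show "AE w in disk_measure. norm (kN N w * v w) \<le> B * norm (v w)" for N
      by (rule AE_in_disk) (auto simp: norm_mult intro!: mult_right_mono kN_b)
    show "integrable disk_measure (\<lambda>w. B * norm (v w))" using v by simp
  qed measurable
  moreover have "(LINT w|disk_measure. kN N w * v w) = (\<Sum>n\<in>{- int N..int N}. ?c n * hmon n z)" for N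
  proof -
    have ie: "integrable disk_measure (\<lambda>w. e n w * v w)" for n
    proof (cases "n \<in> S")
      case True
      have "integrable disk_measure (\<lambda>w. (of_real (wt n) * hmon n z) * (v w * cnj (hmon n w)))"
        using integrable_cnj_hmon[OF v, of n] by simp
      then show ?thesis using True by (simp add: e_def mult_ac)
    qed (simp add: e_def)
    have ce: "(LINT w|disk_measure. e n w * v w) = ?c n * hmon n z" for n
    proof (cases "n \<in> S")
      case True
      then have "(LINT w|disk_measure. e n w * v w)
          = (LINT w|disk_measure. (of_real (wt n) * hmon n z) * (v w * cnj (hmon n w)))"
        by (simp add: e_def mult_ac)
      then show ?thesis using True by (simp add: coef_def)
    qed (simp add: e_def)
    have "(LINT w|disk_measure. kN N w * v w) = (LINT w|disk_measure. (\<Sum>n\<in>{- int N..int N}. e n w * v w))"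
      by (simp add: kN_def sum_distrib_right)
    also have "\<dots> = (\<Sum>n\<in>{- int N..int N}. LINT w|disk_measure. e n w * v w)"
      using ie by (rule Bochner_Integration.integral_sum)
    finally show ?thesis by (simp only: ce)
  qed
  ultimately have lim: "(\<lambda>N. \<Sum>n\<in>{- int N..int N}. ?c n * hmon n z) \<longlonglongrightarrow> (LINT w|disk_measure. k z w * v w)"
    by simp
  define K where "K = (LINT z|disk_measure. norm (v z))"
  have "norm (?c n) \<le> K * wt n" for n
    using coef_growth[OF v, of n] by (auto simp: K_def)
  then have hs: "((\<lambda>n. ?c n * hmon n z) has_sum (\<Sum>\<^sub>\<infinity>n. ?c n * hmon n z)) UNIV"
    using z by (intro has_sum_infsum growth_summable)
  then have "(\<Sum>\<^sub>\<infinity>n. ?c n * hmon n z) = (LINT w|disk_measure. k z w * v w)"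
    using lim by (intro LIMSEQ_unique[OF has_sum_symmetric_partial])
  with hs z show "((\<lambda>n. ?c n * hmon n z) has_sum on_disk (\<lambda>z. LINT w|disk_measure. k z w * v w) z) UNIV"
    by (simp add: on_disk_def)
qed (simp add: on_disk_def)

lemma bergman_proj_expansion:
  assumes "integrable disk_measure v"
  shows "expansion (bergman_proj v) (\<lambda>n. if n \<in> {0..} then coef n v else 0)"
  using kernel_expansion[OF assms bergman_kernel_has_sum] by (simp add: bergman_proj_def)

lemma harmonic_proj_expansion:
  assumes "integrable disk_measure v"
  shows "expansion (harmonic_proj v) (\<lambda>n. if n \<in> UNIV then coef n v else 0)"
  using kernel_expansion[OF assms harmonic_kernel_has_sum] by (simp add: harmonic_proj_def)

text \<open>Both Bergman spaces at once: \<open>S\<close> is the set of all integers in the harmonic and the set of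
  nonnegative integers in the analytic case.\<close>
definition hspace :: "int set \<Rightarrow> (complex \<Rightarrow> complex) set" where
  "hspace S = {f. square_integrable f \<and> (\<exists>c. expansion f c \<and> (\<forall>n. n \<notin> S \<longrightarrow> c n = 0))}"

lemma expansion_in_hspace:
  "square_integrable f \<Longrightarrow> expansion f c \<Longrightarrow> (\<And>n. n \<notin> S \<Longrightarrow> c n = 0) \<Longrightarrow> f \<in> hspace S"
  unfolding hspace_def by blast

lemma hspaceD:
  assumes "f \<in> hspace S"
  shows "square_integrable f" "expansion f (\<lambda>n. coef n f)" "n \<notin> S \<Longrightarrow> coef n f = 0"
proof -
  obtain c where c: "square_integrable f" "expansion f c" "\<forall>n. n \<notin> S \<longrightarrow> c n = 0"
    using assms by (auto simp: hspace_def)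
  have "coef n f = c n" for n by (rule expansion_coef[OF c(2) square_integrable_integrable[OF c(1)]])
  with c show "square_integrable f" "expansion f (\<lambda>n. coef n f)" "n \<notin> S \<Longrightarrow> coef n f = 0"
    by auto
qed

lemma hspace_eqI:
  assumes "f \<in> hspace S" "g \<in> hspace S" "\<And>n. n \<in> S \<Longrightarrow> coef n f = coef n g"
  shows "f = g"
proof -
  have "coef n f = coef n g" for n
    using assms(3)[of n] hspaceD(3)[OF assms(1), of n] hspaceD(3)[OF assms(2), of n] by (cases "n \<in> S") auto
  then have "(\<lambda>n. coef n f) = (\<lambda>n. coef n g)" by (rule ext)
  then show ?thesis using expansion_unique[OF hspaceD(2)[OF assms(1)], of g] hspaceD(2)[OF assms(2)] by simp
qed

lemma hspaceI:
  assumes e: "expansion f c" and S: "\<And>n. n \<notin> S \<Longrightarrow> c n = 0"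
    and M: "\<And>F. finite F \<Longrightarrow> (\<Sum>n\<in>F. (norm (c n))\<^sup>2 / wt n) \<le> M"
  shows "f \<in> hspace S" "(L2_norm_disk f)\<^sup>2 \<le> M" "coef n f = c n"
proof -
  show sq: "(L2_norm_disk f)\<^sup>2 \<le> M" using expansion_norm_le[OF e M] by blast
  have s: "square_integrable f" using expansion_norm_le[OF e M] by blast
  then show "f \<in> hspace S" using e S by (auto simp: hspace_def)
  show "coef n f = c n" by (rule expansion_coef[OF e square_integrable_integrable[OF s]])
qed

text \<open>Riesz--Fischer for these spaces. A bound on the weighted square sum makes the coefficients grow
  at most linearly, so the series converges in the disk.\<close>
lemma hspace_exists:
  assumes S: "\<And>n. n \<notin> S \<Longrightarrow> c n = 0"
    and M: "\<And>F. finite F \<Longrightarrow> (\<Sum>n\<in>F. (norm (c n))\<^sup>2 / wt n) \<le> M"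
  obtains f where "f \<in> hspace S" "\<And>n. coef n f = c n" "(L2_norm_disk f)\<^sup>2 \<le> M"
proof -
  have "norm (c n) \<le> (M + 1) * wt n" for n
  proof (rule power2_le_imp_le)
    have M0: "0 \<le> M" using M[of "{}"] by simp
    have "(norm (c n))\<^sup>2 \<le> M * wt n"
      using M[of "{n}"] by (simp add: field_simps)
    also have "\<dots> \<le> (M + 1)\<^sup>2 * (wt n)\<^sup>2"
    proof (rule mult_mono)
      show "M \<le> (M + 1)\<^sup>2" using M0 by (simp add: power2_sum)
      show "wt n \<le> (wt n)\<^sup>2" using self_le_power[of "wt n" 2] by simp
    qed (use M0 in auto)
    finally show "(norm (c n))\<^sup>2 \<le> ((M + 1) * wt n)\<^sup>2" by (simp add: power_mult_distrib)
    show "0 \<le> (M + 1) * wt n" using M0 by simp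
  qed
  note h = hspaceI[OF growth_expansion[OF this] S M]
  show ?thesis by (rule that[OF h(1) h(3) h(2)])
qed

lemma hspace_add:
  assumes "f \<in> hspace S" "g \<in> hspace S" shows "(\<lambda>z. f z + g z) \<in> hspace S"
  by (rule expansion_in_hspace[OF square_integrable_add expansion_add])
     (use assms in \<open>auto intro: hspaceD simp: hspaceD(3)\<close>)

lemma hspace_scale:
  assumes "f \<in> hspace S" shows "(\<lambda>z. a * f z) \<in> hspace S"
  by (rule expansion_in_hspace[OF square_integrable_scale expansion_scale])
     (use assms in \<open>auto intro: hspaceD simp: hspaceD(3)\<close>)

lemma hspace_diff:
  assumes "f \<in> hspace S" "g \<in> hspace S" shows "(\<lambda>z. f z - g z) \<in> hspace S"
  using hspace_add[OF assms(1) hspace_scale[OF assms(2), of "-1"]] by simp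

lemma hspace_mono: "S \<subseteq> S' \<Longrightarrow> hspace S \<subseteq> hspace S'"
  unfolding hspace_def by blast

lemma hpoly_hspace: "finite F \<Longrightarrow> F \<subseteq> S \<Longrightarrow> hpoly F c \<in> hspace S"
  by (rule expansion_in_hspace[OF hpoly_square_integrable hpoly_expansion]) auto

lemma coef_hspace_diff:
  assumes "f \<in> hspace S" "g \<in> hspace S" shows "coef n (\<lambda>z. f z - g z) = coef n f - coef n g"
  using assms by (intro coef_diff square_integrable_integrable hspaceD(1))

lemma coef_hspace_add:
  assumes "f \<in> hspace S" "g \<in> hspace S" shows "coef n (\<lambda>z. f z + g z) = coef n f + coef n g"
  using assms by (intro coef_add square_integrable_integrable hspaceD(1))

text \<open>A finite \<open>F\<close> whose square sum comes within \<open>e\<close> of the supremum over all finite sets leaves a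
  remainder with every square sum at most \<open>e\<close>.\<close>
lemma hpoly_dense:
  assumes f: "f \<in> hspace S" and e: "e > 0"
  obtains F where "finite F" "F \<subseteq> S" "(L2_norm_disk (\<lambda>z. f z - hpoly F (\<lambda>n. coef n f) z))\<^sup>2 \<le> e"
proof -
  define E where "E F = (\<Sum>n\<in>F. (norm (coef n f))\<^sup>2 / wt n)" for F
  define m where "m = Sup (E ` {F. finite F \<and> F \<subseteq> S})"
  have bdd: "bdd_above (E ` {F. finite F \<and> F \<subseteq> S})"
    using bessel_inequality[OF hspaceD(1)[OF f]] unfolding E_def by (auto intro!: bdd_aboveI)
  have "m - e < m" using e by simp
  then obtain F where F: "finite F" "F \<subseteq> S" "m - e < E F"
    unfolding m_def by (subst (asm) less_cSup_iff[OF _ bdd]) auto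
  define g where "g = (\<lambda>z. f z - hpoly F (\<lambda>n. coef n f) z)"
  have g: "g \<in> hspace S" unfolding g_def using F by (intro hspace_diff f hpoly_hspace)
  have cg: "coef n g = (if n \<in> F then 0 else coef n f)" for n
    unfolding g_def using F coef_hspace_diff[OF f hpoly_hspace[OF F(1,2)]] by (auto simp: coef_hpoly)
  have "(L2_norm_disk g)\<^sup>2 \<le> e"
  proof (rule hspaceI(2)[OF hspaceD(2)[OF g]])
    fix G :: "int set" assume G: "finite G"
    have "(\<Sum>n\<in>G. (norm (coef n g))\<^sup>2 / wt n) = E (G \<inter> S - F)"
      unfolding E_def using G cg hspaceD(3)[OF f] by (intro sum.mono_neutral_cong_right) auto
    also have "\<dots> = E ((G \<inter> S) \<union> F) - E F"
      unfolding E_def using G F sum.subset_diff[of F "(G \<inter> S) \<union> F" "\<lambda>n. (norm (coef n f))\<^sup>2 / wt n"]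
      by (simp add: Un_Diff)
    also have "E ((G \<inter> S) \<union> F) \<le> m"
      unfolding m_def using G F by (intro cSup_upper bdd) auto
    finally show "(\<Sum>n\<in>G. (norm (coef n g))\<^sup>2 / wt n) \<le> e" using F(3) by simp
  qed (use hspaceD(3)[OF g] in auto)
  then show ?thesis using that F g_def by blast
qed

lemma hmon_uminus: "hmon (- n) z = cnj (hmon n z)"
  by (cases "n = 0") (auto simp: hmon_def)

lemma expansion_cnj:
  assumes "expansion f c" shows "expansion (\<lambda>z. cnj (f z)) (\<lambda>n. cnj (c (- n)))"
  unfolding expansion_def
proof (intro conjI allI impI ballI)
  fix z :: complex assume z: "z \<in> \<bbbD>"
  have "((\<lambda>n. cnj (c n * hmon n z)) has_sum cnj (f z)) UNIV"
    using assms z unfolding expansion_def by (simp only: has_sum_cnj_iff)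
  then have "((\<lambda>n. cnj (c (- n) * hmon (- n) z)) has_sum cnj (f z)) UNIV"
    by (subst has_sum_reindex_bij_betw[of uminus UNIV UNIV "\<lambda>n. cnj (c n * hmon n z)"]) (auto intro: bij_uminus)
  then show "((\<lambda>n. cnj (c (- n)) * hmon n z) has_sum cnj (f z)) UNIV"
    by (simp add: hmon_uminus)
qed (use assms in \<open>simp add: expansion_def\<close>)

lemma holomorphic_expansion:
  assumes "f holomorphic_on \<bbbD>" "\<And>z. z \<notin> \<bbbD> \<Longrightarrow> f z = 0"
  obtains c where "expansion f c" "\<And>n. n < 0 \<Longrightarrow> c n = 0"
proof
  define a where "a n = (deriv ^^ n) f 0 / fact n" for n
  define c where "c n = (if n \<ge> 0 then a (nat n) else 0)" for n
  have s: "(\<lambda>n. a n * z ^ n) sums f z" if "z \<in> \<bbbD>" for z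
    using holomorphic_power_series[OF assms(1) that] by (simp add: a_def)
  show "c n = 0" if "n < 0" for n using that by (simp add: c_def)
  show "expansion f c" unfolding expansion_def
  proof (intro conjI allI impI ballI)
    fix z :: complex assume z: "z \<in> \<bbbD>"
    then obtain r where r: "norm z < r" "r < 1" using dense by auto
    then have "r \<ge> 0" using norm_ge_zero[of z] by linarith
    then have "norm (of_real r :: complex) = r" by simp
    then have "summable (\<lambda>n. norm (a n * z ^ n))"
      using r s[of "of_real r"] by (intro powser_insidea[of a "of_real r"]) (auto simp: sums_iff)
    then have "((\<lambda>n. a n * z ^ n) has_sum f z) UNIV"
      by (rule norm_summable_imp_has_sum[OF _ s[OF z]])
    then have "((\<lambda>n. c (int n) * hmon (int n) z) has_sum f z) UNIV"
      by (simp add: c_def hmon_int)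
    from has_sum_int[OF this, of 0] show "((\<lambda>n. c n * hmon n z) has_sum f z) UNIV"
      by (simp add: c_def)
  qed (use assms in auto)
qed

lemma expansion_holomorphic:
  assumes e: "expansion f c" and c: "\<And>n. n < 0 \<Longrightarrow> c n = 0"
  shows "f holomorphic_on \<bbbD>"
proof (rule power_series_holomorphic[where a = "\<lambda>n. c (int n)"])
  fix z :: complex assume z: "z \<in> \<bbbD>"
  have "((\<lambda>n. c n * hmon n z) has_sum f z) UNIV" using e z by (simp add: expansion_def)
  then have "((\<lambda>n. c n * hmon n z) has_sum f z) (range int)"
  proof (rule iffD1[OF has_sum_cong_neutral, rotated -1])
    fix x :: int assume "x \<in> UNIV - range int"
    then have "x < 0" by (metis DiffD2 nonneg_int_cases not_less rangeI)
    then show "c x * hmon x z = 0" using c by simp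
  qed auto
  then have "((\<lambda>n. c (int n) * z ^ n) has_sum f z) UNIV"
    by (subst (asm) has_sum_reindex) (auto simp: o_def hmon_int)
  then show "(\<lambda>n. c (int n) * (z - 0) ^ n) sums f z"
    using has_sum_imp_sums by fastforce
qed

lemma bergman_eq: "bergman = hspace {0..}"
proof (intro equalityI subsetI)
  fix f assume f: "f \<in> bergman"
  then obtain c where "expansion f c" "\<And>n. n < 0 \<Longrightarrow> c n = 0"
    using holomorphic_expansion[of f] unfolding bergman_def by auto
  then show "f \<in> hspace {0..}" using f unfolding hspace_def bergman_def by auto
next
  fix f assume f: "f \<in> hspace {0..}"
  then show "f \<in> bergman"
    using expansion_holomorphic[OF hspaceD(2)[OF f]] hspaceD[OF f] unfolding bergman_def
    by (auto simp: expansion_def)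
qed

lemma square_integrable_cnj: "square_integrable f \<Longrightarrow> square_integrable (\<lambda>z. cnj (f z))"
  unfolding square_integrable_def by auto

lemma hspace_cnj:
  assumes "f \<in> hspace S" shows "(\<lambda>z. cnj (f z)) \<in> hspace (uminus ` S)"
proof -
  have "cnj (coef (- n) f) = 0" if "n \<notin> uminus ` S" for n
    using that hspaceD(3)[OF assms, of "- n"] by (metis complex_cnj_zero image_eqI minus_minus)
  then show ?thesis
    using square_integrable_cnj[OF hspaceD(1)[OF assms]] expansion_cnj[OF hspaceD(2)[OF assms]]
    unfolding hspace_def by blast
qed

text \<open>The nontrivial direction splits a harmonic function into its analytic and its antianalytic part;
  both are square integrable because their square sums are parts of that of the whole.\<close>
lemma harmonic_bergman_eq: "harmonic_bergman = hspace UNIV"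
proof (intro equalityI subsetI)
  fix h assume "h \<in> harmonic_bergman"
  then obtain f g where "h = (\<lambda>z. f z + cnj (g z))" "f \<in> hspace {0..}" "g \<in> hspace {0..}"
    unfolding harmonic_bergman_def bergman_eq by auto
  then show "h \<in> hspace UNIV"
    using hspace_mono[of _ UNIV] hspace_cnj[of g] by (auto intro!: hspace_add)
next
  fix h assume h: "h \<in> hspace UNIV"
  have part: "\<exists>f\<in>hspace S. \<forall>n. coef n f = (if n \<in> S then coef n h else 0)" for S
  proof -
    have "(\<Sum>n\<in>F. (norm (if n \<in> S then coef n h else 0))\<^sup>2 / wt n) \<le> (L2_norm_disk h)\<^sup>2" if "finite F" for F
      by (rule order_trans[OF sum_mono bessel_inequality[OF hspaceD(1)[OF h] that]]) auto
    then obtain f where "f \<in> hspace S" "\<And>n. coef n f = (if n \<in> S then coef n h else 0)"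
      by (rule hspace_exists[rotated]) auto
    then show ?thesis by blast
  qed
  obtain f where f: "f \<in> hspace {0..}" "\<And>n. coef n f = (if n \<in> {0..} then coef n h else 0)"
    using part by blast
  obtain g where g: "g \<in> hspace {..<0}" "\<And>n. coef n g = (if n \<in> {..<0} then coef n h else 0)"
    using part by blast
  have fU: "f \<in> hspace UNIV" "g \<in> hspace UNIV" using f g hspace_mono[of _ UNIV] by auto
  have "h = (\<lambda>z. f z + g z)"
    using coef_hspace_add[OF fU] by (intro hspace_eqI[OF h hspace_add[OF fU]]) (auto simp: f g)
  then have "h = (\<lambda>z. f z + cnj (cnj (g z)))" by simp
  moreover have "(\<lambda>z. cnj (g z)) \<in> hspace {0..}"
    using hspace_cnj[OF g(1)] hspace_mono[of "uminus ` {..<0}" "{0::int..}"] by fastforce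
  ultimately show "h \<in> harmonic_bergman"
    using f(1) unfolding harmonic_bergman_def bergman_eq
    by (intro CollectI, rule_tac x = f in exI, rule_tac x = "\<lambda>z. cnj (g z)" in exI) simp
qed

section \<open>The action of quasihomogeneous symbols on monomials\<close>

definition radial_moment :: "(complex \<Rightarrow> complex) \<Rightarrow> nat \<Rightarrow> complex" where
  "radial_moment \<phi> s = (LINT z|disk_measure. \<phi> z * of_real (norm z ^ s))"

text \<open>The weight at \<open>n\<close> of the Toeplitz operator with symbol \<open>e\<^sup>i\<^sup>k\<^sup>\<theta> \<phi>\<close>, that is, the factor with which it
  sends the monomial of index \<open>n\<close> to the one of index \<open>n + k\<close>.\<close>
definition sym_coef :: "int \<Rightarrow> (complex \<Rightarrow> complex) \<Rightarrow> int \<Rightarrow> complex" where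
  "sym_coef k \<phi> n = of_real (wt (n + k)) * radial_moment \<phi> (nat \<bar>n\<bar> + nat \<bar>n + k\<bar>)"

lemma hmon_polar: "hmon n z = of_real (norm z ^ nat \<bar>n\<bar>) * cis (of_int n * Arg z)"
proof -
  have "hmon n (cis (Arg z) * of_real (norm z)) = cis (of_int n * Arg z) * hmon n (of_real (norm z))"
    by (rule hmon_rotate)
  moreover have "cis (Arg z) * of_real (norm z) = z"
    using rcis_cmod_Arg[of z] by (simp add: rcis_def mult.commute)
  moreover have "hmon n (of_real (norm z)) = of_real (norm z ^ nat \<bar>n\<bar>)"
    by (simp add: hmon_def)
  ultimately show ?thesis by (simp add: mult.commute)
qed

lemma cis_Arg_measurable [measurable]: "(\<lambda>z. cis (of_int k * Arg z)) \<in> borel_measurable disk_measure"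
proof -
  have "cis (of_int k * Arg z) = (if z = 0 then 1 else hmon k z / of_real (norm z ^ nat \<bar>k\<bar>))" for z
    by (simp add: hmon_polar Arg_zero)
  then have "(\<lambda>z. cis (of_int k * Arg z)) = (\<lambda>z. if z = 0 then 1 else hmon k z / of_real (norm z ^ nat \<bar>k\<bar>))"
    by (rule ext)
  then show ?thesis by simp
qed

lemma integrable_quasihom:
  assumes "integrable disk_measure \<phi>" shows "integrable disk_measure (quasihom k \<phi>)"
  using integrable_bounded_times[OF assms cis_Arg_measurable[of k], of 1]
  by (simp add: quasihom_def mult.commute)

lemma AE_disk_nonzero: "AE z in disk_measure. z \<noteq> 0"
proof (rule AE_I[where N = "{0}"])
  have s: "{0::complex} \<in> sets disk_measure"
    by (simp add: sets_disk_measure sets_restrict_space_iff)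
  then show "emeasure disk_measure {0} = 0" "{0} \<in> sets disk_measure"
    by (simp_all add: emeasure_disk_measure)
qed auto

text \<open>The integrand is radial up to the factor \<open>e\<^sup>i\<^sup>d\<^sup>\<theta>\<close> with \<open>d = n + k - m\<close>, so the integral vanishes
  unless \<open>d = 0\<close>.\<close>
lemma integral_quasihom_hmon:
  assumes \<phi>: "integrable disk_measure \<phi>" and r: "radial \<phi>"
  shows "(LINT z|disk_measure. quasihom k \<phi> z * hmon n z * cnj (hmon m z))
    = (if m = n + k then radial_moment \<phi> (nat \<bar>n\<bar> + nat \<bar>m\<bar>) else 0)"
proof -
  define d where "d = n + k - m"
  define F where "F z = \<phi> z * of_real (norm z ^ (nat \<bar>n\<bar> + nat \<bar>m\<bar>)) * cis (of_int d * Arg z)" for z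
  have [measurable]: "\<phi> \<in> borel_measurable disk_measure" using \<phi> by auto
  have eq: "quasihom k \<phi> z * hmon n z * cnj (hmon m z) = F z" for z
  proof -
    have c: "cis (of_int d * Arg z) = cis (of_int k * Arg z) * cis (of_int n * Arg z) * cis (- (of_int m * Arg z))"
      by (simp add: cis_mult d_def algebra_simps)
    show ?thesis
      unfolding F_def quasihom_def hmon_polar complex_cnj_mult complex_cnj_complex_of_real cis_cnj
        power_add of_real_mult c
      by (simp only: mult_ac)
  qed
  show ?thesis
  proof (cases "m = n + k")
    case True
    then have "F z = \<phi> z * of_real (norm z ^ (nat \<bar>n\<bar> + nat \<bar>m\<bar>))" for z
      by (simp add: F_def d_def)
    with True show ?thesis unfolding eq by (simp add: radial_moment_def)
  next
    case False
    then have d: "d \<noteq> 0" by (simp add: d_def)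
    define u where "u = cis (pi / of_int d)"
    obtain g where g: "AE z in disk_measure. \<phi> z = g (norm z)" using r by (auto simp: radial_def)
    have u: "norm u = 1" by (simp add: u_def)
    have "AE z in disk_measure. F (u * z) = - F z"
      using g AE_disk_rotate[OF u g] AE_disk_nonzero
    proof eventually_elim
      case (elim z)
      \<comment> \<open>the angular factor is a monomial divided by a power of the modulus\<close>
      have "hmon d (u * z) = - hmon d z"
        using hmon_rotate[of d "pi / of_int d" z] cis_half_turn[OF d] by (simp add: u_def)
      then have "of_real (norm z ^ nat \<bar>d\<bar>) * cis (of_int d * Arg (u * z)) = of_real (norm z ^ nat \<bar>d\<bar>) * - cis (of_int d * Arg z)"
        unfolding hmon_polar norm_mult u by simp
      then have "cis (of_int d * Arg (u * z)) = - cis (of_int d * Arg z)"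
        using elim by (subst (asm) mult_cancel_left) auto
      moreover have "\<phi> (u * z) = \<phi> z" using elim u by (simp add: norm_mult)
      ultimately show ?case using u by (simp add: F_def norm_mult)
    qed
    moreover have "F \<in> borel_measurable disk_measure" unfolding F_def by measurable
    ultimately have "(LINT z|disk_measure. F z) = 0"
      using disk_integral_antisymmetric u by blast
    then show ?thesis using False unfolding eq by simp
  qed
qed

lemma integrable_times_hpoly:
  assumes v: "integrable disk_measure v" and F: "finite F"
  shows "integrable disk_measure (\<lambda>w. v w * hpoly F c w)"
proof (rule integrable_bounded_times[OF v])
  show "hpoly F c \<in> borel_measurable disk_measure"
    using expansion_measurable[OF hpoly_expansion[OF F]] .
  fix z :: complex assume z: "z \<in> \<bbbD>"
  show "norm (hpoly F c z) \<le> (\<Sum>n\<in>F. norm (c n))"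
    unfolding hpoly_in_disk[OF z] using z
    by (intro sum_norm_le) (auto simp: norm_mult intro!: mult_left_le norm_hmon_le)
qed

lemma coef_quasihom_hpoly:
  assumes \<phi>: "integrable disk_measure \<phi>" and r: "radial \<phi>" and F: "finite F"
  shows "coef m (\<lambda>w. quasihom k \<phi> w * hpoly F c w)
    = sym_coef k \<phi> (m - k) * (if m - k \<in> F then c (m - k) else 0)"
proof -
  note q = integrable_quasihom[OF \<phi>, of k]
  have i: "integrable disk_measure (\<lambda>z. quasihom k \<phi> z * hmon n z * cnj (hmon m z))" for n
    by (intro integrable_cnj_hmon integrable_bounded_times[OF q, where B = 1]) (auto intro!: norm_hmon_le)
  have "(LINT z|disk_measure. quasihom k \<phi> z * hpoly F c z * cnj (hmon m z))
      = (LINT z|disk_measure. (\<Sum>n\<in>F. c n * (quasihom k \<phi> z * hmon n z * cnj (hmon m z))))"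
    by (rule Bochner_Integration.integral_cong)
       (auto simp: hpoly_in_disk sum_distrib_left sum_distrib_right mult_ac)
  also have "\<dots> = (\<Sum>n\<in>F. c n * (LINT z|disk_measure. quasihom k \<phi> z * hmon n z * cnj (hmon m z)))"
    using i by (subst Bochner_Integration.integral_sum) auto
  also have "\<dots> = (\<Sum>n\<in>F. if n = m - k then c (m - k) * radial_moment \<phi> (nat \<bar>m - k\<bar> + nat \<bar>m\<bar>) else 0)"
    by (rule sum.cong) (auto simp: integral_quasihom_hmon[OF \<phi> r])
  also have "\<dots> = (if m - k \<in> F then c (m - k) * radial_moment \<phi> (nat \<bar>m - k\<bar> + nat \<bar>m\<bar>) else 0)"
    using F by (simp add: sum.delta)
  finally show ?thesis by (simp add: coef_def sym_coef_def)
qed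

lemma hpoly_harmonic_polys: "finite F \<Longrightarrow> hpoly F c \<in> harmonic_polys"
proof -
  assume F: "finite F"
  define p where "p = (\<Sum>n\<in>F \<inter> {0..}. monom (c n) (nat n))"
  define q where "q = (\<Sum>n\<in>F \<inter> {..<0}. monom (cnj (c n)) (nat (- n)))"
  have "(\<Sum>n\<in>F. c n * hmon n z) = poly p z + cnj (poly q z)" for z
  proof -
    have "(\<Sum>n\<in>F. c n * hmon n z) = (\<Sum>n\<in>F \<inter> {0..}. c n * hmon n z) + (\<Sum>n\<in>F \<inter> {..<0}. c n * hmon n z)"
      using F by (subst sum.union_disjoint[symmetric]) (auto intro!: sum.cong)
    also have "(\<Sum>n\<in>F \<inter> {0..}. c n * hmon n z) = poly p z"
      by (auto simp: p_def poly_sum poly_monom hmon_def intro!: sum.cong)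
    also have "(\<Sum>n\<in>F \<inter> {..<0}. c n * hmon n z) = cnj (poly q z)"
      by (auto simp: q_def poly_sum poly_monom hmon_def intro!: sum.cong)
    finally show ?thesis .
  qed
  then show ?thesis unfolding harmonic_polys_def hpoly_def by auto
qed

lemma hpoly_analytic_polys: "finite F \<Longrightarrow> F \<subseteq> {0..} \<Longrightarrow> hpoly F c \<in> analytic_polys"
proof -
  assume F: "finite F" "F \<subseteq> {0..}"
  define p where "p = (\<Sum>n\<in>F. monom (c n) (nat n))"
  have "(\<Sum>n\<in>F. c n * hmon n z) = poly p z" for z
    using F by (auto simp: p_def poly_sum poly_monom hmon_def intro!: sum.cong)
  then show ?thesis unfolding analytic_polys_def hpoly_def by auto
qed

text \<open>The index set is left free so that two polynomials of different degree can be summed over the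
  same set.\<close>
lemma poly_hmon_sum:
  assumes "int ` {..degree p} \<subseteq> F" "finite F"
  shows "poly p z = (\<Sum>n\<in>F. (if n \<ge> 0 then coeff p (nat n) else 0) * hmon n z)"
proof -
  have "poly p z = (\<Sum>n\<in>int ` {..degree p}. (if n \<ge> 0 then coeff p (nat n) else 0) * hmon n z)"
    by (subst sum.reindex) (auto simp: poly_altdef hmon_int)
  also have "\<dots> = (\<Sum>n\<in>F. (if n \<ge> 0 then coeff p (nat n) else 0) * hmon n z)"
  proof (rule sum.mono_neutral_left[OF assms(2,1)], rule ballI)
    fix n assume n: "n \<in> F - int ` {..degree p}"
    have "coeff p (nat n) = 0" if "n \<ge> 0"
    proof (rule coeff_eq_0, rule ccontr)
      assume "\<not> degree p < nat n"
      then have "n \<in> int ` {..degree p}" using that by (intro image_eqI[of _ _ "nat n"]) auto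
      with n show False by simp
    qed
    then show "(if n \<ge> 0 then coeff p (nat n) else 0) * hmon n z = 0" by simp
  qed
  finally show ?thesis .
qed

lemma analytic_polys_hpoly:
  assumes "h \<in> analytic_polys" obtains F c where "finite F" "F \<subseteq> {0..}" "h = hpoly F c"
proof -
  obtain p where p: "h = on_disk (poly p)" using assms by (auto simp: analytic_polys_def)
  show ?thesis
  proof (rule that)
    show "h = hpoly (int ` {..degree p}) (\<lambda>n. if n \<ge> 0 then coeff p (nat n) else 0)"
      unfolding p hpoly_def by (intro arg_cong[of _ _ on_disk] ext poly_hmon_sum) auto
  qed auto
qed

lemma harmonic_polys_hpoly:
  assumes "h \<in> harmonic_polys" obtains F c where "finite F" "h = hpoly F c"
proof -
  obtain p q where pq: "h = on_disk (\<lambda>z. poly p z + cnj (poly q z))"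
    using assms by (auto simp: harmonic_polys_def)
  define N where "N = int (max (degree p) (degree q))"
  define c where "c n = (if n \<ge> 0 then coeff p (nat n) else 0)
    + cnj (if - n \<ge> 0 then coeff q (nat (- n)) else 0)" for n
  have "poly p z + cnj (poly q z) = (\<Sum>n\<in>{-N..N}. c n * hmon n z)" for z
  proof -
    have "poly p z = (\<Sum>n\<in>{-N..N}. (if n \<ge> 0 then coeff p (nat n) else 0) * hmon n z)"
      by (rule poly_hmon_sum) (auto simp: N_def)
    moreover have "poly q z = (\<Sum>n\<in>{-N..N}. (if n \<ge> 0 then coeff q (nat n) else 0) * hmon n z)"
      by (rule poly_hmon_sum) (auto simp: N_def)
    then have "poly q z = (\<Sum>n\<in>{-N..N}. (if - n \<ge> 0 then coeff q (nat (- n)) else 0) * hmon (- n) z)"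
      by (subst sum.reindex_bij_witness[of _ uminus uminus]) auto
    then have "cnj (poly q z) = (\<Sum>n\<in>{-N..N}. cnj (if - n \<ge> 0 then coeff q (nat (- n)) else 0) * hmon n z)"
      by (simp add: hmon_uminus)
    ultimately show ?thesis unfolding c_def by (simp only: sum.distrib distrib_right)
  qed
  then have "h = hpoly {-N..N} c" unfolding pq hpoly_def by simp
  then show ?thesis using that by blast
qed

section \<open>Boundedness of the weights\<close>

text \<open>A radial \<open>\<phi>\<close> acts diagonally, and the T-function hypothesis tested on a single monomial bounds
  the eigenvalue.\<close>
lemma T_function_diagonal_bound:
  assumes T: "T_function \<phi>" and r: "radial \<phi>"
  obtains C where "C \<ge> 0" "\<And>n. norm (sym_coef 0 \<phi> n) \<le> C"
proof -
  obtain C where C: "\<And>h. h \<in> harmonic_polys \<Longrightarrow> harmonic_proj (\<lambda>w. \<phi> w * h w) \<in> harmonic_bergman \<and>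
        L2_norm_disk (harmonic_proj (\<lambda>w. \<phi> w * h w)) \<le> C * L2_norm_disk h"
    using T unfolding T_function_def by blast
  have \<phi>: "integrable disk_measure \<phi>" using T by (simp add: T_function_def)
  have q0: "quasihom 0 \<phi> = \<phi>" by (simp add: quasihom_def)
  have "norm (sym_coef 0 \<phi> n) \<le> \<bar>C\<bar>" for n
  proof (rule power2_le_imp_le)
    define h where "h = hpoly {n} (\<lambda>_. 1)"
    define v where "v = (\<lambda>w. \<phi> w * h w)"
    define f where "f = harmonic_proj v"
    have f: "f \<in> hspace UNIV" "L2_norm_disk f \<le> C * L2_norm_disk h"
      using C[of h] hpoly_harmonic_polys[of "{n}"] unfolding f_def v_def h_def harmonic_bergman_eq by auto
    have v: "integrable disk_measure v"
      unfolding v_def h_def by (rule integrable_times_hpoly[OF \<phi>]) simp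
    have "coef n f = coef n v"
      using expansion_coef[OF harmonic_proj_expansion[OF v] square_integrable_integrable] hspaceD(1)[OF f(1)]
      by (simp add: f_def)
    also have "\<dots> = sym_coef 0 \<phi> n"
      using coef_quasihom_hpoly[OF \<phi> r, of "{n}" n 0 "\<lambda>_. 1"] by (simp add: q0 v_def h_def)
    finally have "(norm (sym_coef 0 \<phi> n))\<^sup>2 \<le> wt n * (L2_norm_disk f)\<^sup>2"
      using coef_le_norm[OF hspaceD(1)[OF f(1)], of n] by simp
    also have "\<dots> \<le> wt n * (C * L2_norm_disk h)\<^sup>2"
      by (intro mult_left_mono power_mono f) auto
    also have "\<dots> = \<bar>C\<bar>\<^sup>2"
      using norm_hpoly[of "{n}" "\<lambda>_. 1"] by (simp add: power_mult_distrib h_def)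
    finally show "(norm (sym_coef 0 \<phi> n))\<^sup>2 \<le> \<bar>C\<bar>\<^sup>2" .
  qed simp
  then show ?thesis using that[of "\<bar>C\<bar>"] by simp
qed

text \<open>From \<open>(s + 1) r\<^sup>s (1 - r) \<le> (1 - r) (1 + r + \<dots> + r\<^sup>s) \<le> 1\<close> and Bernoulli's inequality
  \<open>1 - r\<^sup>d \<le> d (1 - r)\<close>.\<close>
lemma power_gap_bound:
  fixes r :: real
  assumes "0 \<le> r" "r \<le> 1"
  shows "real (s + 1) * \<bar>r ^ (s + d) - r ^ s\<bar> \<le> real d"
proof -
  have "real (s + 1) * r ^ s = (\<Sum>i<s+1. r ^ s)" by simp
  also have "\<dots> \<le> (\<Sum>i<s+1. r ^ i)" using assms by (intro sum_mono power_decreasing) auto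
  finally have "(1 - r) * (real (s + 1) * r ^ s) \<le> (1 - r) * (\<Sum>i<s+1. r ^ i)"
    using assms by (intro mult_left_mono) auto
  also have "\<dots> = 1 - r ^ (s + 1)" by (rule one_diff_power_eq[symmetric])
  also have "\<dots> \<le> 1" using assms by simp
  finally have 1: "(1 - r) * (real (s + 1) * r ^ s) \<le> 1" .
  have "1 + real d * (r - 1) \<le> (1 + (r - 1)) ^ d" using assms by (intro Bernoulli_inequality) auto
  then have 2: "1 - r ^ d \<le> real d * (1 - r)" by (simp add: algebra_simps)
  have "\<bar>r ^ (s + d) - r ^ s\<bar> = r ^ s * (1 - r ^ d)"
  proof -
    have "r ^ (s + d) \<le> r ^ s" using assms by (intro power_decreasing) auto
    then show ?thesis by (simp add: power_add algebra_simps)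
  qed
  also have "\<dots> \<le> r ^ s * (real d * (1 - r))" using assms by (intro mult_left_mono 2) auto
  finally have "real (s + 1) * \<bar>r ^ (s + d) - r ^ s\<bar> \<le> real (s + 1) * (r ^ s * (real d * (1 - r)))"
    by (intro mult_left_mono) auto
  also have "\<dots> = real d * ((1 - r) * (real (s + 1) * r ^ s))" by (simp only: mult_ac)
  also have "\<dots> \<le> real d * 1" using 1 by (intro mult_left_mono) auto
  finally show ?thesis by simp
qed

text \<open>The moments of an integrable function vary slowly: those of neighbouring orders differ by
  \<open>O(1 / s)\<close>, although the moments themselves may decay arbitrarily slowly.\<close>
lemma radial_moment_gap:
  assumes \<phi>: "integrable disk_measure \<phi>"
  shows "real (s + 1) * norm (radial_moment \<phi> (s + d) - radial_moment \<phi> s)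
    \<le> real d * (LINT z|disk_measure. norm (\<phi> z))"
proof -
  have i: "integrable disk_measure (\<lambda>z. \<phi> z * of_real (norm z ^ j))" for j
    by (rule integrable_bounded_times[OF \<phi>, where B = 1]) (auto simp: norm_power power_le_one)
  have "real (s + 1) * norm (radial_moment \<phi> (s + d) - radial_moment \<phi> s)
      = norm (LINT z|disk_measure. of_nat (s + 1) * (\<phi> z * of_real (norm z ^ (s + d)) - \<phi> z * of_real (norm z ^ s)))"
    unfolding radial_moment_def using i
    by (simp only: integral_mult_right_zero Bochner_Integration.integral_diff norm_mult norm_of_nat)
  also have "\<dots> \<le> (LINT z|disk_measure. real d * norm (\<phi> z))"
  proof (rule order_trans[OF integral_norm_bound integral_mono])
    show "integrable disk_measure (\<lambda>z. norm (of_nat (s + 1) * (\<phi> z * of_real (norm z ^ (s + d)) - \<phi> z * of_real (norm z ^ s))))"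
      using i by simp
    show "integrable disk_measure (\<lambda>z. real d * norm (\<phi> z))" using \<phi> by simp
    fix z assume "z \<in> space disk_measure"
    then have z: "0 \<le> norm z" "norm z \<le> 1" by auto
    have "norm (of_nat (s + 1) * (\<phi> z * of_real (norm z ^ (s + d)) - \<phi> z * of_real (norm z ^ s)) :: complex)
        = norm (of_nat (s + 1) * (of_real (norm z ^ (s + d) - norm z ^ s) :: complex) * \<phi> z)"
      by (simp only: of_real_diff) (simp add: algebra_simps)
    also have "\<dots> = real (s + 1) * \<bar>norm z ^ (s + d) - norm z ^ s\<bar> * norm (\<phi> z)"
      by (simp only: norm_mult norm_of_nat norm_of_real)
    also have "\<dots> \<le> real d * norm (\<phi> z)"
      by (intro mult_right_mono power_gap_bound z) auto
    finally show "norm (of_nat (s + 1) * (\<phi> z * of_real (norm z ^ (s + d)) - \<phi> z * of_real (norm z ^ s)))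
      \<le> real d * norm (\<phi> z)" .
  qed
  finally show ?thesis by simp
qed

text \<open>The case \<open>k = 0\<close> controls only moments of even order. Changing the order of a moment by at most
  \<open>\<bar>k\<bar>\<close> costs a term of the same size \<open>O(1 / (m + 1))\<close>, by \<open>radial_moment_gap\<close>, so the moments of
  order \<open>\<bar>n\<bar> + \<bar>n + k\<bar>\<close> are bounded by comparing with the even order \<open>2 m\<close>, where \<open>m\<close> is the minimum
  of \<open>\<bar>n\<bar>\<close> and \<open>\<bar>n + k\<bar>\<close>.\<close>
lemma sym_coef_bounded:
  assumes \<phi>: "radial_T_function \<phi>"
  obtains A where "\<And>n. norm (sym_coef k \<phi> n) \<le> A"
proof -
  have i: "integrable disk_measure \<phi>" and r: "radial \<phi>" and T: "T_function \<phi>"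
    using \<phi> by (auto simp: radial_T_function_def T_function_def)
  obtain C where C: "C \<ge> 0" "\<And>n. norm (sym_coef 0 \<phi> n) \<le> C"
    using T_function_diagonal_bound[OF T r] by blast
  define L where "L = (LINT z|disk_measure. norm (\<phi> z))"
  have L: "L \<ge> 0" unfolding L_def by simp
  define b where "b = real (nat \<bar>k\<bar>)"
  have "norm (sym_coef k \<phi> n) \<le> (1 + b) * (C + b * L)" for n
  proof -
    define m where "m = min (nat \<bar>n\<bar>) (nat \<bar>n + k\<bar>)"
    define d where "d = nat \<bar>n\<bar> + nat \<bar>n + k\<bar> - 2 * m"
    have s: "nat \<bar>n\<bar> + nat \<bar>n + k\<bar> = 2 * m + d" and d: "d \<le> nat \<bar>k\<bar>" and w: "nat \<bar>n + k\<bar> \<le> m + nat \<bar>k\<bar>"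
      unfolding d_def m_def min_def by (auto; arith)+
    have "real (m + 1) * norm (radial_moment \<phi> (2 * m)) \<le> C"
      using C(2)[of "int m"] unfolding sym_coef_def norm_mult norm_of_real by (simp add: mult_2 add.commute)
    moreover have "real (m + 1) * norm (radial_moment \<phi> (2 * m + d) - radial_moment \<phi> (2 * m)) \<le> b * L"
    proof -
      have "real (m + 1) * norm (radial_moment \<phi> (2 * m + d) - radial_moment \<phi> (2 * m))
          \<le> real (2 * m + 1) * norm (radial_moment \<phi> (2 * m + d) - radial_moment \<phi> (2 * m))"
        by (intro mult_right_mono) auto
      also have "\<dots> \<le> real d * L" unfolding L_def by (rule radial_moment_gap[OF i])
      also have "\<dots> \<le> b * L" using d L by (intro mult_right_mono) (auto simp: b_def)
      finally show ?thesis .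
    qed
    moreover have "norm (radial_moment \<phi> (2 * m + d)) \<le> norm (radial_moment \<phi> (2 * m))
        + norm (radial_moment \<phi> (2 * m + d) - radial_moment \<phi> (2 * m))"
      by (rule norm_triangle_sub)
    then have "real (m + 1) * norm (radial_moment \<phi> (2 * m + d)) \<le> real (m + 1) * (norm (radial_moment \<phi> (2 * m))
        + norm (radial_moment \<phi> (2 * m + d) - radial_moment \<phi> (2 * m)))"
      by (rule mult_left_mono) simp
    ultimately have M: "real (m + 1) * norm (radial_moment \<phi> (2 * m + d)) \<le> C + b * L"
      unfolding distrib_left by linarith
    have "wt (n + k) = real (nat \<bar>n + k\<bar>) + 1" by (simp add: wt_def)
    also have "\<dots> \<le> real m + b + 1" using w by (simp add: b_def)
    also have "\<dots> \<le> (1 + b) * real (m + 1)" by (simp add: b_def algebra_simps)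
    finally have "norm (sym_coef k \<phi> n) \<le> (1 + b) * real (m + 1) * norm (radial_moment \<phi> (2 * m + d))"
      unfolding sym_coef_def s norm_mult by (intro mult_right_mono) auto
    also have "\<dots> = (1 + b) * (real (m + 1) * norm (radial_moment \<phi> (2 * m + d)))" by (simp only: mult.assoc)
    also have "\<dots> \<le> (1 + b) * (C + b * L)" by (intro mult_left_mono M) (simp add: b_def)
    finally show ?thesis .
  qed
  then show ?thesis using that by blast
qed

section \<open>Toeplitz operators as weighted shifts\<close>

text \<open>A shift by \<open>k\<close> distorts the norms of the monomials by a bounded factor only:
  \<open>wt (m - k) \<le> wt k * wt m\<close>.\<close>
lemma shift_exists:
  assumes f: "f \<in> hspace S" and A: "\<And>n. norm (a n) \<le> A"
  obtains g where "g \<in> hspace S" "\<And>m. coef m g = (if m \<in> S then a (m - k) * coef (m - k) f else 0)"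
    "(L2_norm_disk g)\<^sup>2 \<le> A\<^sup>2 * wt k * (L2_norm_disk f)\<^sup>2"
proof (rule hspace_exists[where S = S and M = "A\<^sup>2 * wt k * (L2_norm_disk f)\<^sup>2"
      and c = "\<lambda>m. if m \<in> S then a (m - k) * coef (m - k) f else 0"])
  fix F :: "int set" assume F: "finite F"
  have A0: "A \<ge> 0" using A[of 0] norm_ge_zero order_trans by blast
  have "(\<Sum>m\<in>F. (norm (if m \<in> S then a (m - k) * coef (m - k) f else 0))\<^sup>2 / wt m)
      \<le> (\<Sum>m\<in>F. A\<^sup>2 * wt k * ((norm (coef (m - k) f))\<^sup>2 / wt (m - k)))"
  proof (rule sum_mono)
    fix m
    have "wt (m - k) \<le> wt k * wt m"
    proof -
      have "wt k * wt m = \<bar>real_of_int k\<bar> * \<bar>real_of_int m\<bar> + \<bar>real_of_int k\<bar> + \<bar>real_of_int m\<bar> + 1"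
        by (simp add: wt_def algebra_simps)
      moreover have "0 \<le> \<bar>real_of_int k\<bar> * \<bar>real_of_int m\<bar>" by simp
      moreover have "wt (m - k) \<le> \<bar>real_of_int m\<bar> + \<bar>real_of_int k\<bar> + 1" by (simp add: wt_def)
      ultimately show ?thesis by linarith
    qed
    then have w: "1 / wt m \<le> wt k / wt (m - k)" by (simp add: field_simps)
    have "(norm (if m \<in> S then a (m - k) * coef (m - k) f else 0))\<^sup>2 \<le> A\<^sup>2 * (norm (coef (m - k) f))\<^sup>2"
      using A[of "m - k"] by (auto simp: norm_mult power_mult_distrib intro!: mult_right_mono power_mono)
    then have "(norm (if m \<in> S then a (m - k) * coef (m - k) f else 0))\<^sup>2 * (1 / wt m)
        \<le> (A\<^sup>2 * (norm (coef (m - k) f))\<^sup>2) * (wt k / wt (m - k))"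
      using w by (intro mult_mono) auto
    then show "(norm (if m \<in> S then a (m - k) * coef (m - k) f else 0))\<^sup>2 / wt m
        \<le> A\<^sup>2 * wt k * ((norm (coef (m - k) f))\<^sup>2 / wt (m - k))"
      by (simp add: mult_ac)
  qed
  also have "\<dots> = A\<^sup>2 * wt k * (\<Sum>n\<in>(\<lambda>m. m - k) ` F. (norm (coef n f))\<^sup>2 / wt n)"
    by (subst sum.reindex) (auto simp: sum_distrib_left inj_on_def)
  also have "\<dots> \<le> A\<^sup>2 * wt k * (L2_norm_disk f)\<^sup>2"
    using F by (intro mult_left_mono bessel_inequality[OF hspaceD(1)[OF f]]) auto
  finally show "(\<Sum>m\<in>F. (norm (if m \<in> S then a (m - k) * coef (m - k) f else 0))\<^sup>2 / wt m)
      \<le> A\<^sup>2 * wt k * (L2_norm_disk f)\<^sup>2" .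
qed (use that in auto)

text \<open>Operators are compared coefficientwise: the coefficients of \<open>T g\<close> are bounded by a multiple of
  the norm of \<open>g\<close>, which is arbitrarily small when \<open>g\<close> is \<open>f\<close> minus a suitable partial sum.\<close>
lemma bounded_operators_agree:
  assumes T: "bounded_operator_on (hspace S) T" and T': "bounded_operator_on (hspace S) T'"
    and eq: "\<And>F c. finite F \<Longrightarrow> F \<subseteq> S \<Longrightarrow> T (hpoly F c) = T' (hpoly F c)"
    and f: "f \<in> hspace S"
  shows "T f = T' f"
proof (rule hspace_eqI)
  show Tf: "T f \<in> hspace S" "T' f \<in> hspace S" using T T' f by (auto simp: bounded_operator_on_def)
  fix m
  define E where "E g = coef m (T g) - coef m (T' g)" for g
  have diff: "coef m (U (\<lambda>z. f z - h z)) = coef m (U f) - coef m (U h)"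
    if U: "bounded_operator_on (hspace S) U" and h: "h \<in> hspace S" for U h
  proof -
    have "U (f + (\<lambda>z. (-1) * h z)) = U f + U (\<lambda>z. (-1) * h z)"
      using U f hspace_scale[OF h] unfolding bounded_operator_on_def by blast
    also have "U (\<lambda>z. (-1) * h z) = (\<lambda>z. (-1) * U h z)"
      using U h unfolding bounded_operator_on_def by blast
    finally have "U (\<lambda>z. f z - h z) = (\<lambda>z. U f z - U h z)" by (simp add: plus_fun_def)
    moreover have "U f \<in> hspace S" "U h \<in> hspace S" using U f h by (auto simp: bounded_operator_on_def)
    ultimately show ?thesis using coef_hspace_diff by metis
  qed
  have bound: "\<exists>K\<ge>0. \<forall>g\<in>hspace S. norm (coef m (U g)) \<le> K * L2_norm_disk g"
    if U: "bounded_operator_on (hspace S) U" for U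
  proof -
    obtain C where C: "\<And>g. g \<in> hspace S \<Longrightarrow> L2_norm_disk (U g) \<le> C * L2_norm_disk g"
      using U unfolding bounded_operator_on_def by blast
    have "norm (coef m (U g)) \<le> (wt m * \<bar>C\<bar>) * L2_norm_disk g" if g: "g \<in> hspace S" for g
    proof (rule power2_le_imp_le)
      have "U g \<in> hspace S" using U g by (auto simp: bounded_operator_on_def)
      then have "(norm (coef m (U g)))\<^sup>2 \<le> wt m * (L2_norm_disk (U g))\<^sup>2"
        by (intro coef_le_norm hspaceD(1))
      also have "\<dots> \<le> (wt m)\<^sup>2 * (C * L2_norm_disk g)\<^sup>2"
        using self_le_power[of "wt m" 2] by (intro mult_mono power_mono C g) auto
      finally show "(norm (coef m (U g)))\<^sup>2 \<le> (wt m * \<bar>C\<bar> * L2_norm_disk g)\<^sup>2"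
        by (simp add: power_mult_distrib)
    qed simp
    then show ?thesis by (intro exI[of _ "wt m * \<bar>C\<bar>"]) auto
  qed
  obtain K K' where K: "K \<ge> 0" "\<And>g. g \<in> hspace S \<Longrightarrow> norm (coef m (T g)) \<le> K * L2_norm_disk g"
    and K': "K' \<ge> 0" "\<And>g. g \<in> hspace S \<Longrightarrow> norm (coef m (T' g)) \<le> K' * L2_norm_disk g"
    using bound[OF T] bound[OF T'] by blast
  have "norm (E f) \<le> 0 + e" if e: "e > 0" for e
  proof -
    define d where "d = e / (K + K' + 1)"
    have d: "d > 0" using e K(1) K'(1) by (simp add: d_def)
    then have "d\<^sup>2 > 0" by simp
    then obtain F where F: "finite F" "F \<subseteq> S"
      and le: "(L2_norm_disk (\<lambda>z. f z - hpoly F (\<lambda>n. coef n f) z))\<^sup>2 \<le> d\<^sup>2"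
      using hpoly_dense[OF f] by blast
    define h where "h = hpoly F (\<lambda>n. coef n f)"
    define g where "g = (\<lambda>z. f z - h z)"
    have h: "h \<in> hspace S" unfolding h_def by (rule hpoly_hspace[OF F])
    have g: "g \<in> hspace S" unfolding g_def by (rule hspace_diff[OF f h])
    have ng: "L2_norm_disk g \<le> d"
      using le less_imp_le[OF d] unfolding g_def h_def by (rule power2_le_imp_le)
    have "E f = E g"
      using diff[OF T h] diff[OF T' h] eq[OF F] unfolding E_def g_def by (simp add: h_def)
    also have "norm \<dots> \<le> (K + K') * L2_norm_disk g"
      unfolding E_def using norm_triangle_ineq4[of "coef m (T g)" "coef m (T' g)"] K(2)[OF g] K'(2)[OF g]
      by (simp add: distrib_right)
    also have "\<dots> \<le> (K + K' + 1) * d"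
      using ng K(1) K'(1) by (intro mult_mono) auto
    also have "\<dots> = e" using K(1) K'(1) by (simp add: d_def)
    finally show ?thesis by simp
  qed
  then have "norm (E f) \<le> 0" by (rule field_le_epsilon)
  then show "coef m (T f) = coef m (T' f)" by (simp add: E_def)
qed

text \<open>On the harmonic space (\<open>S\<close> the set of all integers) this is a weighted shift by \<open>k\<close> with weights
  \<open>a\<close>; on the analytic space it is followed by the projection that discards negative indices.\<close>
definition is_shift :: "int set \<Rightarrow> int \<Rightarrow> (int \<Rightarrow> complex) \<Rightarrow> ((complex \<Rightarrow> complex) \<Rightarrow> complex \<Rightarrow> complex) \<Rightarrow> bool" where
  "is_shift S k a T \<longleftrightarrow> (\<forall>f\<in>hspace S. T f \<in> hspace S \<and>
     (\<forall>m. coef m (T f) = (if m \<in> S then a (m - k) * coef (m - k) f else 0)))"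

text \<open>The operator with the prescribed coefficients is bounded and agrees with \<open>R\<close> on the polynomials;
  as these are dense, it is the only such operator, which makes the definite description in
  \<^const>\<open>bounded_extension\<close> meaningful.\<close>
lemma bounded_extension_is_shift:
  assumes P: "\<And>F c. finite F \<Longrightarrow> F \<subseteq> S \<Longrightarrow> hpoly F c \<in> P"
    and P': "\<And>h. h \<in> P \<Longrightarrow> \<exists>F c. finite F \<and> F \<subseteq> S \<and> h = hpoly F c"
    and R: "\<And>F c. finite F \<Longrightarrow> F \<subseteq> S \<Longrightarrow>
      expansion (R (hpoly F c)) (\<lambda>m. if m \<in> S then a (m - k) * (if m - k \<in> F then c (m - k) else 0) else 0)"
    and A: "\<And>n. norm (a n) \<le> A"
  shows "is_shift S k a (bounded_extension (hspace S) P R)"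
proof -
  define Q where "Q f g \<longleftrightarrow> g \<in> hspace S \<and> (\<forall>m. coef m g = (if m \<in> S then a (m - k) * coef (m - k) f else 0))
    \<and> (L2_norm_disk g)\<^sup>2 \<le> A\<^sup>2 * wt k * (L2_norm_disk f)\<^sup>2" for f g
  define T where "T f = (if f \<in> hspace S then SOME g. Q f g else undefined)" for f
  have "Q f (T f)" if f: "f \<in> hspace S" for f
  proof -
    have "\<exists>g. Q f g"
      unfolding Q_def by (rule shift_exists[where k = k and a = a, OF f A]) blast
    then have "Q f (SOME g. Q f g)" by (rule someI_ex)
    then show ?thesis using f by (simp add: T_def)
  qed
  then have T: "T f \<in> hspace S" "\<And>m. coef m (T f) = (if m \<in> S then a (m - k) * coef (m - k) f else 0)"
      "(L2_norm_disk (T f))\<^sup>2 \<le> A\<^sup>2 * wt k * (L2_norm_disk f)\<^sup>2" if "f \<in> hspace S" for f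
    using that by (auto simp: Q_def)
  have bT: "bounded_operator_on (hspace S) T"
    unfolding bounded_operator_on_def
  proof (intro conjI ballI allI)
    fix f assume f: "f \<in> hspace S"
    show "T f \<in> hspace S" by (rule T[OF f])
    show "T (\<lambda>z. c * f z) = (\<lambda>z. c * T f z)" for c
      by (rule hspace_eqI[OF T(1)[OF hspace_scale[OF f]] hspace_scale[OF T(1)[OF f]]])
         (simp add: T[OF hspace_scale[OF f]] T[OF f] coef_scale)
    fix g assume g: "g \<in> hspace S"
    show "T (f + g) = T f + T g"
      unfolding plus_fun_def
      by (rule hspace_eqI[OF T(1)[OF hspace_add[OF f g]] hspace_add[OF T(1)[OF f] T(1)[OF g]]])
         (simp add: T[OF hspace_add[OF f g]] T[OF f] T[OF g] coef_hspace_add[OF f g]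
            coef_hspace_add[OF T(1)[OF f] T(1)[OF g]] distrib_left)
  next
    show "\<exists>C. \<forall>f\<in>hspace S. L2_norm_disk (T f) \<le> C * L2_norm_disk f"
    proof (intro exI ballI)
      fix f assume f: "f \<in> hspace S"
      have "sqrt ((L2_norm_disk (T f))\<^sup>2) \<le> sqrt (A\<^sup>2 * wt k * (L2_norm_disk f)\<^sup>2)"
        using T(3)[OF f] by (rule real_sqrt_le_mono)
      then show "L2_norm_disk (T f) \<le> sqrt (A\<^sup>2 * wt k) * L2_norm_disk f"
        by (simp add: real_sqrt_mult)
    qed
  qed
  have TR: "T (hpoly F c) = R (hpoly F c)" if F: "finite F" "F \<subseteq> S" for F c
  proof -
    note h = hpoly_hspace[OF F, of c]
    have "expansion (T (hpoly F c)) (\<lambda>m. if m \<in> S then a (m - k) * (if m - k \<in> F then c (m - k) else 0) else 0)"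
      using hspaceD(2)[OF T(1)[OF h]] by (simp only: T(2)[OF h] coef_hpoly[OF F(1)])
    then show ?thesis using R[OF F] by (rule expansion_unique)
  qed
  have "bounded_extension (hspace S) P R = T"
    unfolding bounded_extension_def
  proof (rule the_equality)
    show "T \<in> extensional (hspace S) \<and> bounded_operator_on (hspace S) T \<and> (\<forall>h\<in>P. T h = R h)"
    proof (intro conjI ballI bT)
      show "T \<in> extensional (hspace S)" by (simp add: T_def extensional_def)
      fix h assume "h \<in> P"
      then obtain F c where h: "finite F" "F \<subseteq> S" "h = hpoly F c" using P' by blast
      show "T h = R h" unfolding h(3) by (rule TR[OF h(1,2)])
    qed
  next
    fix U assume U: "U \<in> extensional (hspace S) \<and> bounded_operator_on (hspace S) U \<and> (\<forall>h\<in>P. U h = R h)"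
    show "U = T"
    proof
      fix f show "U f = T f"
      proof (cases "f \<in> hspace S")
        case True
        show ?thesis
          using U TR P by (intro bounded_operators_agree[OF _ bT _ True]) auto
      next
        case False
        then show ?thesis using U by (auto simp: T_def extensional_def)
      qed
    qed
  qed
  then show ?thesis unfolding is_shift_def using T by simp
qed

lemma toeplitz_h_is_shift:
  assumes \<phi>: "radial_T_function \<phi>"
  shows "is_shift UNIV k (sym_coef k \<phi>) (toeplitz_h (quasihom k \<phi>))"
proof -
  have i: "integrable disk_measure \<phi>" and r: "radial \<phi>"
    using \<phi> by (auto simp: radial_T_function_def T_function_def)
  obtain A where A: "\<And>n. norm (sym_coef k \<phi> n) \<le> A" using sym_coef_bounded[OF \<phi>] by blast
  show ?thesis unfolding toeplitz_h_def harmonic_bergman_eq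
  proof (rule bounded_extension_is_shift[where A = A])
    fix F :: "int set" and c assume F: "finite F"
    show "hpoly F c \<in> harmonic_polys" by (rule hpoly_harmonic_polys[OF F])
    show "expansion (harmonic_proj (\<lambda>w. quasihom k \<phi> w * hpoly F c w))
        (\<lambda>m. if m \<in> UNIV then sym_coef k \<phi> (m - k) * (if m - k \<in> F then c (m - k) else 0) else 0)"
      using harmonic_proj_expansion[OF integrable_times_hpoly[OF integrable_quasihom[OF i] F], of k c]
      by (simp only: coef_quasihom_hpoly[OF i r F])
  next
    fix h assume "h \<in> harmonic_polys"
    then obtain F c where "finite F" "h = hpoly F c" by (rule harmonic_polys_hpoly)
    then show "\<exists>F c. finite F \<and> F \<subseteq> UNIV \<and> h = hpoly F c" by blast
  qed (rule A)
qed

lemma toeplitz_a_is_shift: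
  assumes \<phi>: "radial_T_function \<phi>"
  shows "is_shift {0..} k (sym_coef k \<phi>) (toeplitz_a (quasihom k \<phi>))"
proof -
  have i: "integrable disk_measure \<phi>" and r: "radial \<phi>"
    using \<phi> by (auto simp: radial_T_function_def T_function_def)
  obtain A where A: "\<And>n. norm (sym_coef k \<phi> n) \<le> A" using sym_coef_bounded[OF \<phi>] by blast
  show ?thesis unfolding toeplitz_a_def bergman_eq
  proof (rule bounded_extension_is_shift[where A = A])
    fix F :: "int set" and c assume F: "finite F" "F \<subseteq> {0..}"
    show "hpoly F c \<in> analytic_polys" by (rule hpoly_analytic_polys[OF F])
    show "expansion (bergman_proj (\<lambda>w. quasihom k \<phi> w * hpoly F c w))
        (\<lambda>m. if m \<in> {0..} then sym_coef k \<phi> (m - k) * (if m - k \<in> F then c (m - k) else 0) else 0)"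
      using bergman_proj_expansion[OF integrable_times_hpoly[OF integrable_quasihom[OF i] F(1)], of k c]
      by (simp only: coef_quasihom_hpoly[OF i r F(1)])
  next
    fix h assume "h \<in> analytic_polys"
    then obtain F c where "finite F" "F \<subseteq> {0..}" "h = hpoly F c" by (rule analytic_polys_hpoly)
    then show "\<exists>F c. finite F \<and> F \<subseteq> {0..} \<and> h = hpoly F c" by blast
  qed (rule A)
qed

text \<open>On the analytic space the inner operator may push an index below \<open>0\<close>, which
  annihilates the monomial; the condition in the weight records this.\<close>
lemma is_shift_comp:
  assumes "is_shift S k1 a1 T1" "is_shift S k2 a2 T2"
  shows "is_shift S (k1 + k2) (\<lambda>n. (if n + k2 \<in> S then a1 (n + k2) * a2 n else 0)) (\<lambda>f. T1 (T2 f))"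
  unfolding is_shift_def
proof (intro ballI conjI allI)
  fix f m assume f: "f \<in> hspace S"
  have 2: "T2 f \<in> hspace S" "coef m (T2 f) = (if m \<in> S then a2 (m - k2) * coef (m - k2) f else 0)" for m
    using assms f by (auto simp: is_shift_def)
  then show "T1 (T2 f) \<in> hspace S" using assms by (auto simp: is_shift_def)
  have "coef m (T1 (T2 f)) = (if m \<in> S then a1 (m - k1) * coef (m - k1) (T2 f) else 0)"
    using assms(1) 2(1) by (simp add: is_shift_def)
  moreover have "m - (k1 + k2) + k2 = m - k1" "m - k1 - k2 = m - (k1 + k2)" by simp_all
  ultimately show "coef m (T1 (T2 f)) = (if m \<in> S then (if m - (k1 + k2) + k2 \<in> S
      then a1 (m - (k1 + k2) + k2) * a2 (m - (k1 + k2)) else 0) * coef (m - (k1 + k2)) f else 0)"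
    by (simp add: 2(2) diff_diff_eq)
qed

lemma is_shift_diff:
  assumes "is_shift S k a T" "is_shift S k b U"
  shows "is_shift S k (\<lambda>n. a n - b n) (\<lambda>f. T f - U f)"
  unfolding is_shift_def
proof (intro ballI conjI allI)
  fix f m assume f: "f \<in> hspace S"
  have h: "T f \<in> hspace S" "U f \<in> hspace S" using assms f by (auto simp: is_shift_def)
  show "T f - U f \<in> hspace S" using hspace_diff[OF h] by (simp add: fun_diff_def)
  show "coef m (T f - U f) = (if m \<in> S then (a (m - k) - b (m - k)) * coef (m - k) f else 0)"
    using assms f coef_hspace_diff[OF h] by (simp add: fun_diff_def is_shift_def left_diff_distrib)
qed

section \<open>Finite rank\<close>

lemma sum_fun_pointwise: "(\<Sum>x\<in>A. f x) z = (\<Sum>x\<in>A. f x z :: 'b :: comm_monoid_add)"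
  by (induction A rule: infinite_finite_induct) auto

lemma coef_span_zero:
  assumes "f \<in> fun_space.span B" "\<And>b. b \<in> B \<Longrightarrow> integrable disk_measure b \<and> coef m b = 0"
  shows "integrable disk_measure f \<and> coef m f = 0"
  using assms(1)
proof (induction rule: fun_space.span_induct_alt)
  case base
  show ?case unfolding zero_fun_def by (simp add: coef_def)
next
  case (step c x y)
  have i: "integrable disk_measure (\<lambda>z. c * x z)" using assms(2)[OF step(1)] by simp
  show ?case
    using i step assms(2)[OF step(1)] coef_add[OF i, of y m]
    by (simp add: plus_fun_def coef_scale)
qed

text \<open>A spanning set has to be found inside \<open>V\<close>: a maximal independent subset of \<open>V\<close> is finite because it lies
  in the span of \<open>E\<close>.\<close>
lemma finite_dimensional_subset_span:
  assumes "finite E" "V \<subseteq> fun_space.span E" shows "finite_dimensional V"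
proof -
  obtain B where B: "B \<subseteq> V" "fun_space.independent B" "V \<subseteq> fun_space.span B"
    by (rule fun_space.maximal_independent_subset)
  have "finite B"
    using fun_space.independent_span_bound[OF assms(1) B(2)] B(1) assms(2) by blast
  with B show ?thesis unfolding finite_dimensional_def by blast
qed

lemma hmon_disk_independent:
  fixes e :: "int \<Rightarrow> complex \<Rightarrow> complex"
  assumes e: "e = (\<lambda>n. hpoly {n} (\<lambda>_. 1))"
  shows "inj e" "fun_space.independent (e ` M)"
proof -
  have c: "coef m (e n) = (if m = n then 1 else 0)" "integrable disk_measure (e n)" for m n
    by (auto simp: e coef_hpoly square_integrable_integrable hpoly_square_integrable)
  show inj: "inj e"
    by (rule injI) (metis c(1) zero_neq_one)
  show "fun_space.independent (e ` M)"
  proof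
    assume "fun_space.dependent (e ` M)"
    then obtain n where n: "n \<in> M" "e n \<in> fun_space.span (e ` M - {e n})"
      by (auto simp: fun_space.dependent_def)
    have "coef n (e n) = 0"
      by (rule coef_span_zero[OF n(2), THEN conjunct2]) (auto simp: c)
    then show False by (simp add: c)
  qed
qed

text \<open>If only finitely many weights are nonzero, the range lies in the span of finitely many monomials.
  This span is closed, because the coefficients are continuous, and so contains the closure of the
  range. Conversely, the range contains the monomial of index \<open>n + k\<close> whenever the weight at \<open>n\<close> is
  nonzero and neither index leaves \<open>S\<close>, and these monomials are independent.\<close>
lemma finite_rank_shift_iff:
  assumes T: "is_shift S k d T"
  shows "finite_rank_on (hspace S) T \<longleftrightarrow> finite {n \<in> S. n + k \<in> S \<and> d n \<noteq> 0}"
proof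
  define N where "N = {n \<in> S. n + k \<in> S \<and> d n \<noteq> 0}"
  define e where "e = (\<lambda>n::int. hpoly {n} (\<lambda>_. 1))"
  note ind = hmon_disk_independent[OF e_def]
  have ce: "coef m (e j) = (if m = j then 1 else 0)" for m j
    by (simp add: e_def coef_hpoly)
  have Tc: "T f \<in> hspace S" "coef m (T f) = (if m \<in> S then d (m - k) * coef (m - k) f else 0)"
    if "f \<in> hspace S" for f m using T that by (auto simp: is_shift_def)
  define V where "V = L2_closure_in (hspace S) (T ` hspace S)"
  {
    assume fin: "finite {n \<in> S. n + k \<in> S \<and> d n \<noteq> 0}"
    define M where "M = (\<lambda>n. n + k) ` N"
    have M: "finite M" "M \<subseteq> S" using fin by (auto simp: M_def N_def)
    have "V \<subseteq> fun_space.span (e ` M)"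
    proof
      fix f assume "f \<in> V"
      then have f: "f \<in> hspace S" and cl: "\<And>\<epsilon>. \<epsilon> > 0 \<Longrightarrow> \<exists>g\<in>T ` hspace S. L2_norm_disk (f - g) < \<epsilon>"
        by (auto simp: V_def L2_closure_in_def)
      have zero: "coef m f = 0" if m: "m \<notin> M" for m
      proof -
        have "norm (coef m f) \<le> 0 + \<epsilon>" if \<epsilon>: "\<epsilon> > 0" for \<epsilon>
        proof -
          have "\<epsilon> / wt m > 0" using \<epsilon> by simp
          then obtain h where h: "h \<in> hspace S" "L2_norm_disk (f - T h) < \<epsilon> / wt m"
            using cl by blast
          have "coef m (T h) = 0"
          proof (cases "m \<in> S \<and> m - k \<in> S")
            case True
            then have "d (m - k) = 0" using m by (auto simp: M_def N_def image_iff) (metis diff_add_cancel)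
            then show ?thesis by (simp add: Tc[OF h(1)])
          next
            case False
            then show ?thesis using hspaceD(3)[OF h(1), of "m - k"] by (auto simp: Tc[OF h(1)])
          qed
          then have c: "coef m (\<lambda>z. f z - T h z) = coef m f"
            using coef_hspace_diff[OF f Tc(1)[OF h(1)]] by simp
          have "norm (coef m f) \<le> wt m * L2_norm_disk (f - T h)"
          proof (rule power2_le_imp_le)
            have "(norm (coef m f))\<^sup>2 \<le> wt m * (L2_norm_disk (f - T h))\<^sup>2"
              using coef_le_norm[OF hspaceD(1)[OF hspace_diff[OF f Tc(1)[OF h(1)]]], of m] c
              by (simp add: fun_diff_def)
            also have "\<dots> \<le> (wt m)\<^sup>2 * (L2_norm_disk (f - T h))\<^sup>2"
              using self_le_power[of "wt m" 2] by (intro mult_right_mono) auto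
            finally show "(norm (coef m f))\<^sup>2 \<le> (wt m * L2_norm_disk (f - T h))\<^sup>2"
              by (simp add: power_mult_distrib)
          qed simp
          also have "\<dots> \<le> wt m * (\<epsilon> / wt m)" using h(2) by (intro mult_left_mono) auto
          finally show ?thesis by simp
        qed
        then have "norm (coef m f) \<le> 0" by (rule field_le_epsilon)
        then show ?thesis by simp
      qed
      have "f = hpoly M (\<lambda>n. coef n f)"
        by (rule hspace_eqI[OF f hpoly_hspace[OF M]]) (auto simp: coef_hpoly[OF M(1)] zero)
      also have "\<dots> = (\<Sum>n\<in>M. (\<lambda>z. coef n f * e n z))"
        by (auto simp: fun_eq_iff e_def hpoly_def on_disk_def sum_fun_pointwise)
      also have "\<dots> \<in> fun_space.span (e ` M)"
        by (intro fun_space.span_sum fun_space.span_scale fun_space.span_base) auto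
      finally show "f \<in> fun_space.span (e ` M)" .
    qed
    then show "finite_rank_on (hspace S) T"
      unfolding finite_rank_on_def V_def[symmetric]
      using M by (intro finite_dimensional_subset_span[of "e ` M"]) auto
  next
    assume "finite_rank_on (hspace S) T"
    then obtain B where B: "finite B" "V \<subseteq> fun_space.span B"
      unfolding finite_rank_on_def V_def[symmetric] finite_dimensional_def by blast
    have "e (n + k) \<in> fun_space.span B" if n: "n \<in> N" for n
    proof -
      have nS: "n \<in> S" "n + k \<in> S" "d n \<noteq> 0" using n by (auto simp: N_def)
      have en: "e n \<in> hspace S" "e (n + k) \<in> hspace S"
        using nS unfolding e_def by (auto intro!: hpoly_hspace)
      have "T (e n) = (\<lambda>z. d n * e (n + k) z)"
        by (rule hspace_eqI[OF Tc(1)[OF en(1)] hspace_scale[OF en(2)]])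
           (auto simp: Tc[OF en(1)] coef_scale ce)
      moreover have "T (e n) \<in> V"
        unfolding V_def L2_closure_in_def
      proof (intro CollectI conjI allI impI)
        show "T (e n) \<in> hspace S" by (rule Tc[OF en(1)])
        fix \<epsilon> :: real assume "\<epsilon> > 0"
        then show "\<exists>g\<in>T ` hspace S. L2_norm_disk (T (e n) - g) < \<epsilon>"
          using en(1) by (intro bexI[of _ "T (e n)"]) (auto simp: L2_norm_disk_def)
      qed
      ultimately have "(\<lambda>z. d n * e (n + k) z) \<in> fun_space.span B" using B by auto
      from fun_space.span_scale[OF this, of "1 / d n"] show ?thesis using nS by simp
    qed
    then have "e ` ((\<lambda>n. n + k) ` N) \<subseteq> fun_space.span B" by auto
    then have "finite (e ` ((\<lambda>n. n + k) ` N))"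
      using fun_space.independent_span_bound[OF B(1) ind(2)] by blast
    then have "finite ((\<lambda>n. n + k) ` N)" using ind(1) by (meson finite_imageD inj_on_subset subset_UNIV)
    then show "finite {n \<in> S. n + k \<in> S \<and> d n \<noteq> 0}"
      unfolding N_def[symmetric] by (rule finite_imageD) (auto simp: inj_on_def)
  }
qed

section \<open>The reflection symmetry of the weights\<close>

text \<open>The reflection \<open>n \<mapsto> - n - K\<close> moves all but finitely many negative integers to nonnegative ones.\<close>
lemma finite_int_one_sided:
  assumes "finite {n::int. n \<ge> 0 \<and> P n}" "finite {n::int. n \<ge> 0 \<and> P (- n - K)}"
  shows "finite {n. P n}"
proof -
  have "n \<in> {n. n \<ge> 0 \<and> P n} \<union> {- \<bar>K\<bar>..0} \<union> (\<lambda>n. - n - K) ` {n. n \<ge> 0 \<and> P (- n - K)}" if "P n" for n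
  proof (cases "n \<ge> 0 \<or> n \<ge> - \<bar>K\<bar>")
    case False
    then have "n = - (- n - K) - K" "- n - K \<ge> 0" by auto
    then show ?thesis using that by (metis (mono_tags, lifting) UnI2 image_eqI mem_Collect_eq)
  qed (use that in auto)
  then have "{n. P n} \<subseteq> {n. n \<ge> 0 \<and> P n} \<union> {- \<bar>K\<bar>..0} \<union> (\<lambda>n. - n - K) ` {n. n \<ge> 0 \<and> P (- n - K)}"
    by blast
  then show ?thesis by (rule finite_subset) (use assms in auto)
qed

lemma finite_nonneg_cong:
  assumes "\<And>n. n \<ge> N \<Longrightarrow> P n \<longleftrightarrow> Q n"
  shows "finite {n::int. n \<ge> 0 \<and> P n} \<longleftrightarrow> finite {n. n \<ge> 0 \<and> Q n}"
proof -
  have "finite {n::int. n \<ge> 0 \<and> P' n}" if "finite {n. n \<ge> 0 \<and> Q' n}" "\<And>n. n \<ge> N \<Longrightarrow> P' n \<longleftrightarrow> Q' n" for P' Q'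
  proof (rule finite_subset)
    show "{n. n \<ge> 0 \<and> P' n} \<subseteq> {0..N} \<union> {n. n \<ge> 0 \<and> Q' n}" using that(2) by auto
  qed (use that in auto)
  then show ?thesis using assms by blast
qed

lemma wt_minus: "wt (- n) = wt n"
  by (simp add: wt_def)

text \<open>The moment in \<open>sym_coef k \<phi> n\<close> depends only on \<open>\<bar>n\<bar>\<close> and \<open>\<bar>n + k\<bar>\<close>, which \<open>n \<mapsto> - n - k\<close>
  exchanges. In the product this reflection reverses the path from \<open>n\<close> to \<open>n + (k1 + k2)\<close>, so that
  the two steps are taken in the opposite order; only the weight at the end point changes.\<close>
lemma sym_coef_product_reflect:
  "sym_coef k1 \<phi>1 (- n - (k1 + k2) + k2) * sym_coef k2 \<phi>2 (- n - (k1 + k2)) / of_real (wt n)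
    = sym_coef k2 \<phi>2 (n + k1) * sym_coef k1 \<phi>1 n / of_real (wt (n + (k1 + k2)))"
proof -
  have r: "- n - (k1 + k2) + k2 = - (n + k1)" "- n - (k1 + k2) = - (n + k1 + k2)"
    "- (n + k1) + k1 = - n" "- (n + k1 + k2) + k2 = - (n + k1)" by auto
  show ?thesis
    unfolding sym_coef_def r abs_minus_cancel wt_minus by (simp add: ac_simps)
qed

lemma sym_coef_reflect_single:
  "sym_coef K \<psi> (- n - K) / of_real (wt n) = sym_coef K \<psi> n / of_real (wt (n + K))"
proof -
  have r: "- n - K = - (n + K)" "- (n + K) + K = - n" by auto
  show ?thesis unfolding sym_coef_def r abs_minus_cancel wt_minus by (simp add: ac_simps)
qed

theorem proposition7p1:
  fixes k1 k2 :: int and \<phi>1 \<phi>2 \<psi> :: "complex \<Rightarrow> complex"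
  assumes "radial_T_function \<phi>1" "radial_T_function \<phi>2" "radial_T_function \<psi>"
  shows
    "(finite_rank_on harmonic_bergman
        (commutator (toeplitz_h (quasihom k1 \<phi>1)) (toeplitz_h (quasihom k2 \<phi>2)))
      \<longleftrightarrow>
      finite_rank_on bergman
        (commutator (toeplitz_a (quasihom k1 \<phi>1)) (toeplitz_a (quasihom k2 \<phi>2))))
     \<and>
     (finite_rank_on harmonic_bergman
        (\<lambda>f. toeplitz_h (quasihom k1 \<phi>1) (toeplitz_h (quasihom k2 \<phi>2) f)
             - toeplitz_h (quasihom (k1 + k2) \<psi>) f)
      \<longrightarrow>
      finite_rank_on bergman
        (\<lambda>f. toeplitz_a (quasihom k1 \<phi>1) (toeplitz_a (quasihom k2 \<phi>2) f)
             - toeplitz_a (quasihom (k1 + k2) \<psi>) f)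
      \<and>
      finite_rank_on bergman
        (\<lambda>f. toeplitz_a (quasihom k2 \<phi>2) (toeplitz_a (quasihom k1 \<phi>1) f)
             - toeplitz_a (quasihom (k1 + k2) \<psi>) f))"
proof -
  define K where "K = k1 + k2"
  \<comment> \<open>from \<^term>\<open>n \<ge> R\<close> on, neither operator produces a negative index\<close>
  define R where "R = \<bar>k1\<bar> + \<bar>k2\<bar>"
  define p where "p n = sym_coef k1 \<phi>1 (n + k2) * sym_coef k2 \<phi>2 n" for n
  define q where "q n = sym_coef k2 \<phi>2 (n + k1) * sym_coef k1 \<phi>1 n" for n
  define c where "c n = sym_coef K \<psi> n" for n
  define pA where "pA n = (if n + k2 \<in> {0..} then p n else 0)" for n
  define qA where "qA n = (if n + k1 \<in> {0..} then q n else 0)" for n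

  have H: "is_shift UNIV K p (\<lambda>f. toeplitz_h (quasihom k1 \<phi>1) (toeplitz_h (quasihom k2 \<phi>2) f))"
    "is_shift UNIV K q (\<lambda>f. toeplitz_h (quasihom k2 \<phi>2) (toeplitz_h (quasihom k1 \<phi>1) f))"
    "is_shift UNIV K c (toeplitz_h (quasihom (k1 + k2) \<psi>))"
    using is_shift_comp[OF toeplitz_h_is_shift[OF assms(1), of k1] toeplitz_h_is_shift[OF assms(2), of k2]]
      is_shift_comp[OF toeplitz_h_is_shift[OF assms(2), of k2] toeplitz_h_is_shift[OF assms(1), of k1]]
      toeplitz_h_is_shift[OF assms(3), of K]
    unfolding p_def q_def c_def by (simp_all add: K_def add.commute)
  have A: "is_shift {0..} K pA (\<lambda>f. toeplitz_a (quasihom k1 \<phi>1) (toeplitz_a (quasihom k2 \<phi>2) f))"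
    "is_shift {0..} K qA (\<lambda>f. toeplitz_a (quasihom k2 \<phi>2) (toeplitz_a (quasihom k1 \<phi>1) f))"
    "is_shift {0..} K c (toeplitz_a (quasihom (k1 + k2) \<psi>))"
    using is_shift_comp[OF toeplitz_a_is_shift[OF assms(1), of k1] toeplitz_a_is_shift[OF assms(2), of k2]]
      is_shift_comp[OF toeplitz_a_is_shift[OF assms(2), of k2] toeplitz_a_is_shift[OF assms(1), of k1]]
      toeplitz_a_is_shift[OF assms(3), of K]
    unfolding pA_def qA_def p_def q_def c_def by (simp_all add: K_def add.commute)

  have rankH: "finite_rank_on harmonic_bergman T \<longleftrightarrow> finite {n. d n \<noteq> 0}"
    if "is_shift UNIV K d T" for d T
    using finite_rank_shift_iff[OF that] by (simp add: harmonic_bergman_eq)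
  have rankA: "finite_rank_on bergman T \<longleftrightarrow> finite {n. n \<ge> 0 \<and> d n \<noteq> 0}"
    if "is_shift {0..} K dA T" "\<And>n. n \<ge> R \<Longrightarrow> dA n = d n" for d dA T
  proof -
    have "finite_rank_on bergman T \<longleftrightarrow> finite {n. n \<ge> 0 \<and> (n + K \<ge> 0 \<and> dA n \<noteq> 0)}"
      using finite_rank_shift_iff[OF that(1)] by (simp add: bergman_eq)
    also have "\<dots> \<longleftrightarrow> finite {n. n \<ge> 0 \<and> d n \<noteq> 0}"
      by (rule finite_nonneg_cong[of R]) (use that(2) in \<open>auto simp: R_def K_def\<close>)
    finally show ?thesis .
  qed
  have far: "pA n = p n" "qA n = q n" if "n \<ge> R" for n
    using that by (auto simp: pA_def qA_def R_def)

  have refl: "p (- n - K) / of_real (wt n) = q n / of_real (wt (n + K))"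
    "q (- n - K) / of_real (wt n) = p n / of_real (wt (n + K))"
    "c (- n - K) / of_real (wt n) = c n / of_real (wt (n + K))" for n
    using sym_coef_product_reflect[of k1 \<phi>1 n k2 \<phi>2] sym_coef_product_reflect[of k2 \<phi>2 n k1 \<phi>1] sym_coef_reflect_single[of K \<psi> n]
    unfolding p_def q_def c_def K_def by (simp_all only: add.commute[of k2 k1])

  \<comment> \<open>the reflection swaps the two products, hence changes the sign of the commutator's weight\<close>
  have comm: "p (- n - K) - q (- n - K) = 0 \<longleftrightarrow> p n - q n = 0" for n
  proof -
    have "(p (- n - K) - q (- n - K)) / of_real (wt n) = - ((p n - q n) / of_real (wt (n + K)))"
      by (simp only: diff_divide_distrib refl) simp
    then show ?thesis by (metis divide_eq_0_iff neg_equal_0_iff_equal of_real_eq_0_iff wt_pos(2))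
  qed
  have semi: "p (- n - K) - c (- n - K) = 0 \<longleftrightarrow> q n - c n = 0" for n
  proof -
    have "(p (- n - K) - c (- n - K)) / of_real (wt n) = (q n - c n) / of_real (wt (n + K))"
      by (simp only: diff_divide_distrib refl)
    then show ?thesis by (metis divide_eq_0_iff of_real_eq_0_iff wt_pos(2))
  qed

  have 1: "finite {n. p n - q n \<noteq> 0} \<longleftrightarrow> finite {n. n \<ge> 0 \<and> p n - q n \<noteq> 0}"
  proof
    assume f: "finite {n. n \<ge> 0 \<and> p n - q n \<noteq> 0}"
    show "finite {n. p n - q n \<noteq> 0}"
      by (rule finite_int_one_sided[where K = K]) (use f in \<open>simp_all only: comm\<close>)
  qed (auto elim: finite_subset[rotated])
  have 2: "finite {n. n \<ge> 0 \<and> p n - c n \<noteq> 0}" "finite {n. n \<ge> 0 \<and> q n - c n \<noteq> 0}"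
    if f: "finite {n. p n - c n \<noteq> 0}"
  proof -
    show "finite {n. n \<ge> 0 \<and> p n - c n \<noteq> 0}" using f by (rule finite_subset[rotated]) auto
    have "{n. q n - c n \<noteq> 0} \<subseteq> (\<lambda>n. - n - K) ` {n. p n - c n \<noteq> 0}"
    proof
      fix n assume "n \<in> {n. q n - c n \<noteq> 0}"
      then have "- n - K \<in> {n. p n - c n \<noteq> 0}" using semi[of n] by blast
      then show "n \<in> (\<lambda>n. - n - K) ` {n. p n - c n \<noteq> 0}" by (rule rev_image_eqI) simp
    qed
    then have "finite {n. q n - c n \<noteq> 0}" using f finite_surj by blast
    then show "finite {n. n \<ge> 0 \<and> q n - c n \<noteq> 0}" by (rule finite_subset[rotated]) auto
  qed
  have rank:
    "finite_rank_on bergman (\<lambda>f. toeplitz_a (quasihom k1 \<phi>1) (toeplitz_a (quasihom k2 \<phi>2) f)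
        - toeplitz_a (quasihom k2 \<phi>2) (toeplitz_a (quasihom k1 \<phi>1) f))
      \<longleftrightarrow> finite {n. n \<ge> 0 \<and> p n - q n \<noteq> 0}"
    "finite_rank_on bergman (\<lambda>f. toeplitz_a (quasihom k1 \<phi>1) (toeplitz_a (quasihom k2 \<phi>2) f)
        - toeplitz_a (quasihom (k1 + k2) \<psi>) f)
      \<longleftrightarrow> finite {n. n \<ge> 0 \<and> p n - c n \<noteq> 0}"
    "finite_rank_on bergman (\<lambda>f. toeplitz_a (quasihom k2 \<phi>2) (toeplitz_a (quasihom k1 \<phi>1) f)
        - toeplitz_a (quasihom (k1 + k2) \<psi>) f)
      \<longleftrightarrow> finite {n. n \<ge> 0 \<and> q n - c n \<noteq> 0}"
    by (rule rankA[OF is_shift_diff[OF A(1,2)]], simp add: far)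
       (rule rankA[OF is_shift_diff[OF A(1,3)]], simp add: far,
        rule rankA[OF is_shift_diff[OF A(2,3)]], simp add: far)
  show ?thesis
    unfolding commutator_def rankH[OF is_shift_diff[OF H(1,2)]] rankH[OF is_shift_diff[OF H(1,3)]] rank
    using 1 2 by blast
qed

end
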